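(* Let $s\ge 1$. Suppose that $U_s$ consists of all inequivalent binary self-dual $[2s,s]$ codes, i.e. $U_s$ contains exactly one code from every equivalence class of binary self-dual $[2s,s]$ codes. Then the set $U_{s+1}$ obtained by the algorithm described in the context (with input set $U_s$ and target dimension $s+1$) consists of all inequivalent binary self-dual $[2s+2,s+1]$ codes, i.e. it contains exactly one code from every equivalence class of binary self-dual $[2s+2,s+1]$ codes.
   Context: All codes are binary linear codes; a self-dual code of dimension $k$ has length $2k$. A permutation $\sigma\in S_n$ acts on a code of length $n$ by moving coordinate $i$ to position $\sigma(i)$. Two codes are equivalent ($\cong$) if one is the image of the other under a coordinate permutation; $\mathrm{Aut}(C)=\{\sigma: \sigma(C)=C\}$. Two coordinates $i,j$ of a code $C$ are called equal if $x_i=x_j$ for all $x\in C$. Canonical forms. Let $\Omega_k$ be the set of all binary self-dual codes of dimension $k$. For each $k\ge 2$ a canonical representative map is fixed: a function $\rho:\Omega_k\to\Omega_k$ with $\rho(X)\cong X$ for all $X$, and $\rho(X)=\rho(Y)$ whenever $X\cong Y$; it is assumed to be chosen so that the last two coordinates of every code $\rho(X)$ are not equal. A canonical permutation of $B\in\Omega_k$ is any $\phi\in S_{2k}$ with $\phi(B)=\rho(B)$. Parent test. Given a canonical permutation $\phi_B$ of $B\in\Omega_k$, let $c_1,c_2$ be the coordinates with $\phi_B(c_1)=2k$, $\phi_B(c_2)=2k-1$. The code $B$ passes the parent test if there is $\sigma\in\mathrm{Aut}(B)$ with $\{\sigma(c_1),\sigma(c_2)\}=\{2k-1,2k\}$;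 equivalently, if there is a canonical permutation $\phi$ of $B$ with $\{\phi(2k-1),\phi(2k)\}=\{2k-1,2k\}$. Child type codes. Let $A$ be a self-dual $[2k-2,k-1]$ code with a generator matrix $G_A$ in systematic form (i.e. containing the identity matrix $I_{k-1}$ in the columns of some information set). For $a=(a_1,\dots,a_{k-1})\in\mathbb{F}_2^{k-1}$ of odd weight, let $C_0$ be the code of length $2k$ generated by $(G_A\mid a^T\ a^T)$, and let $x\in\mathbb{F}_2^{2k}$ be the vector with $x_{2k-1}=1$, $x_{2k}=0$, whose entries in the information positions of $G_A$ are $a_1,\dots,a_{k-1}$ and whose other entries are $0$. The code $\langle C_0,x\rangle$ is a self-dual $[2k,k]$ code, the child type code of $A$ defined by $a$. Each automorphism $P$ of $A$ (as a permutation matrix) determines the invertible matrix $A_P\in\mathrm{GL}(k-1,2)$ with $G_AP=A_PG_A$, and $\mathrm{Aut}(A)$ acts on the odd-weight vectors of $\mathbb{F}_2^{k-1}$ via $a^T\mapsto A_Pa^T$. $Child(A)$ denotes the set of child type codes of $A$ obtained by taking one representative vector $a$ from each orbit of this action. Algorithm. Input: a nonempty set $U_r$ of binary self-dual $[2r,r]$ codes and an integer $k>r$. Output: a set $U_k$ of self-dual $[2k,k]$ codes. Start with $U_k=\emptyset$ and call Augmentation$(A)$ for every $A\in U_r$, where Augmentation$(A)$ is the recursive procedure: if $\dim A=k$, add $A$ to $U_k$; if $\dim A<k$, compute $Child(A)$, and for every $B\in Child(A)$ that passes the parent test, call Augmentation$(B)$. *)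

theory Defs
  imports
    "HOL-Library.Z2"
    "HOL-Combinatorics.Permutations"
    "Jordan_Normal_Form.VS_Connect"
    "Jordan_Normal_Form.DL_Submatrix"
begin

text \<open>
  Binary words of length \<open>n\<close> are elements of \<^term>\<open>carrier_vec n :: bit vec set\<close>. Coordinates are
  numbered from \<open>0\<close>, so the last two coordinates of a word of length \<open>2 * k\<close> are \<open>2 * k - 2\<close>
  and \<open>2 * k - 1\<close>.
\<close>

type_synonym bcode = "bit vec set"

definition linear_code :: "nat \<Rightarrow> bcode \<Rightarrow> bool" where
  "linear_code n C \<longleftrightarrow> VectorSpace.subspace class_ring C (module_vec TYPE(bit) n)"

definition code_dim :: "nat \<Rightarrow> bcode \<Rightarrow> nat" where
  "code_dim n C = vectorspace.dim class_ring ((module_vec TYPE(bit) n)\<lparr>carrier := C\<rparr>)"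

abbreviation code_span :: "nat \<Rightarrow> bcode \<Rightarrow> bcode" where
  "code_span n S \<equiv> LinearCombinations.module.span class_ring (module_vec TYPE(bit) n) S"

definition dual_code :: "nat \<Rightarrow> bcode \<Rightarrow> bcode" where
  "dual_code n C = vec_module.orthogonal_complement n C"

definition self_dual_codes :: "nat \<Rightarrow> bcode set" where
  "self_dual_codes k =
     {C. linear_code (2 * k) C \<and> code_dim (2 * k) C = k \<and> dual_code (2 * k) C = C}"

text \<open>Coordinate \<open>i\<close> is moved to position \<open>\<sigma> i\<close>, that is, entry \<open>\<sigma> i\<close> of the image is entry \<open>i\<close> of \<open>x\<close>.\<close>

definition perm_word :: "nat \<Rightarrow> (nat \<Rightarrow> nat) \<Rightarrow> bit vec \<Rightarrow> bit vec" where
  "perm_word n \<sigma> x = vec n (\<lambda>j. x $ (Hilbert_Choice.inv \<sigma> j))"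

definition perm_code :: "nat \<Rightarrow> (nat \<Rightarrow> nat) \<Rightarrow> bcode \<Rightarrow> bcode" where
  "perm_code n \<sigma> C = perm_word n \<sigma> ` C"

definition code_equiv :: "nat \<Rightarrow> bcode \<Rightarrow> bcode \<Rightarrow> bool" where
  "code_equiv n C D \<longleftrightarrow> (\<exists>\<sigma>. \<sigma> permutes {..<n} \<and> perm_code n \<sigma> C = D)"

definition Aut :: "nat \<Rightarrow> bcode \<Rightarrow> (nat \<Rightarrow> nat) set" where
  "Aut n C = {\<sigma>. \<sigma> permutes {..<n} \<and> perm_code n \<sigma> C = C}"

definition equal_coords :: "bcode \<Rightarrow> nat \<Rightarrow> nat \<Rightarrow> bool" where
  "equal_coords C i j \<longleftrightarrow> (\<forall>x\<in>C. x $ i = x $ j)"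

text \<open>
  A code in \<^term>\<open>self_dual_codes k\<close> determines \<open>k\<close>, so one function serves all dimensions at once.
\<close>

definition canonical_rep_map :: "(bcode \<Rightarrow> bcode) \<Rightarrow> bool" where
  "canonical_rep_map \<rho> \<longleftrightarrow> (\<forall>k\<ge>2.
     (\<forall>X\<in>self_dual_codes k. \<rho> X \<in> self_dual_codes k \<and> code_equiv (2 * k) (\<rho> X) X \<and>
        \<not> equal_coords (\<rho> X) (2 * k - 2) (2 * k - 1)) \<and>
     (\<forall>X\<in>self_dual_codes k. \<forall>Y\<in>self_dual_codes k. code_equiv (2 * k) X Y \<longrightarrow> \<rho> X = \<rho> Y))"

definition canonical_perm :: "(bcode \<Rightarrow> bcode) \<Rightarrow> nat \<Rightarrow> bcode \<Rightarrow> (nat \<Rightarrow> nat) \<Rightarrow> bool" where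
  "canonical_perm \<rho> k B \<phi> \<longleftrightarrow> \<phi> permutes {..<2 * k} \<and> perm_code (2 * k) \<phi> B = \<rho> B"

definition canonical_perm_choice :: "(bcode \<Rightarrow> bcode) \<Rightarrow> (bcode \<Rightarrow> nat \<Rightarrow> nat) \<Rightarrow> bool" where
  "canonical_perm_choice \<rho> \<phi> \<longleftrightarrow> (\<forall>k\<ge>2. \<forall>B\<in>self_dual_codes k. canonical_perm \<rho> k B (\<phi> B))"

definition parent_test :: "(bcode \<Rightarrow> nat \<Rightarrow> nat) \<Rightarrow> nat \<Rightarrow> bcode \<Rightarrow> bool" where
  "parent_test \<phi> k B \<longleftrightarrow>
     (\<exists>c\<^sub>1<2 * k. \<exists>c\<^sub>2<2 * k. \<phi> B c\<^sub>1 = 2 * k - 1 \<and> \<phi> B c\<^sub>2 = 2 * k - 2 \<and>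
        (\<exists>\<sigma>\<in>Aut (2 * k) B. {\<sigma> c\<^sub>1, \<sigma> c\<^sub>2} = {2 * k - 2, 2 * k - 1}))"

text \<open>
  In the following, \<open>m\<close> is the dimension of the parent code \<open>A\<close>, which has length \<open>2 * m\<close>;
  its children have dimension \<open>m + 1\<close> and length \<open>2 * m + 2\<close>.
\<close>

definition systematic_generator :: "nat \<Rightarrow> bcode \<Rightarrow> bit mat \<Rightarrow> nat set \<Rightarrow> bool" where
  "systematic_generator m A G I \<longleftrightarrow>
     G \<in> carrier_mat m (2 * m) \<and> code_span (2 * m) (set (rows G)) = A \<and>
     I \<subseteq> {..<2 * m} \<and> card I = m \<and> submatrix G UNIV I = 1\<^sub>m m"

definition odd_weight_vecs :: "nat \<Rightarrow> bit vec set" where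
  "odd_weight_vecs m = {a \<in> carrier_vec m. odd (card {i. i < m \<and> a $ i = 1})}"

definition extended_generator :: "nat \<Rightarrow> bit mat \<Rightarrow> bit vec \<Rightarrow> bit mat" where
  "extended_generator m G a =
     mat m (2 * m + 2) (\<lambda>(i, j). if j < 2 * m then G $$ (i, j) else a $ i)"

text \<open>
  If \<open>j\<close> is an information position, then \<open>card {l \<in> I. l < j}\<close> is the index of the
  unit column of the identity matrix that stands there.
\<close>

definition child_word :: "nat \<Rightarrow> nat set \<Rightarrow> bit vec \<Rightarrow> bit vec" where
  "child_word m I a = vec (2 * m + 2) (\<lambda>j.
     if j < 2 * m then (if j \<in> I then a $ card {l \<in> I. l < j} else 0)
     else if j = 2 * m then 1 else 0)"

definition child_code :: "nat \<Rightarrow> bit mat \<Rightarrow> nat set \<Rightarrow> bit vec \<Rightarrow> bcode" where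
  "child_code m G I a =
     code_span (2 * m + 2)
       (code_span (2 * m + 2) (set (rows (extended_generator m G a))) \<union> {child_word m I a})"

text \<open>
  The row vector \<open>x P\<close> is \<^term>\<open>perm_word n \<sigma> x\<close> for the permutation matrix \<open>P\<close> of \<open>\<sigma>\<close>.
\<close>

definition perm_mat :: "nat \<Rightarrow> (nat \<Rightarrow> nat) \<Rightarrow> bit mat" where
  "perm_mat n \<sigma> = mat n n (\<lambda>(i, j). if \<sigma> i = j then 1 else 0)"

definition aut_orbit :: "nat \<Rightarrow> bcode \<Rightarrow> bit mat \<Rightarrow> bit vec \<Rightarrow> bit vec set" where
  "aut_orbit m A G a = {M *\<^sub>v a | M \<sigma>. \<sigma> \<in> Aut (2 * m) A \<and>
     M \<in> carrier_mat m m \<and> invertible_mat M \<and> G * perm_mat (2 * m) \<sigma> = M * G}"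

definition orbit_transversal :: "nat \<Rightarrow> bcode \<Rightarrow> bit mat \<Rightarrow> bit vec set \<Rightarrow> bool" where
  "orbit_transversal m A G R \<longleftrightarrow> R \<subseteq> odd_weight_vecs m \<and>
     (\<forall>a\<in>odd_weight_vecs m. \<exists>!b. b \<in> R \<and> b \<in> aut_orbit m A G a)"

text \<open>
  \<open>Child A\<close> depends on the chosen generator matrix, information set and orbit representatives;
  the predicate describes all functions arising from such choices.
\<close>

definition child_map :: "(bcode \<Rightarrow> bcode set) \<Rightarrow> bool" where
  "child_map Child \<longleftrightarrow> (\<forall>m\<ge>1. \<forall>A\<in>self_dual_codes m. \<exists>G I R.
     systematic_generator m A G I \<and> orbit_transversal m A G R \<and> Child A = child_code m G I ` R)"

text \<open>
  \<open>augmentation_call \<phi> Child r U k m A\<close>: on input \<open>U\<close> (codes of length \<open>2 * r\<close>) with target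
  dimension \<open>k\<close>, the recursive procedure is at some point called on the code \<open>A\<close> of length \<open>2 * m\<close>.
\<close>

inductive augmentation_call ::
  "(bcode \<Rightarrow> nat \<Rightarrow> nat) \<Rightarrow> (bcode \<Rightarrow> bcode set) \<Rightarrow> nat \<Rightarrow> bcode set \<Rightarrow> nat \<Rightarrow> nat \<Rightarrow> bcode \<Rightarrow> bool"
  for \<phi> Child r U k where
  start: "A \<in> U \<Longrightarrow> augmentation_call \<phi> Child r U k r A"
| recurse: "augmentation_call \<phi> Child r U k m A \<Longrightarrow> code_dim (2 * m) A < k \<Longrightarrow>
    B \<in> Child A \<Longrightarrow> parent_test \<phi> (Suc m) B \<Longrightarrow> augmentation_call \<phi> Child r U k (Suc m) B"

definition algorithm_output ::
  "(bcode \<Rightarrow> nat \<Rightarrow> nat) \<Rightarrow> (bcode \<Rightarrow> bcode set) \<Rightarrow> nat \<Rightarrow> bcode set \<Rightarrow> nat \<Rightarrow> bcode set" where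
  "algorithm_output \<phi> Child r U k =
     {A. \<exists>m. augmentation_call \<phi> Child r U k m A \<and> code_dim (2 * m) A = k}"

definition all_inequivalent :: "nat \<Rightarrow> bcode set \<Rightarrow> bool" where
  "all_inequivalent k U \<longleftrightarrow> U \<subseteq> self_dual_codes k \<and>
     (\<forall>X\<in>self_dual_codes k. \<exists>!C. C \<in> U \<and> code_equiv (2 * k) X C)"

end

theory Submission
  imports Defs
begin

text \<open>
  If the last two coordinates of a self-dual code \<open>B\<close> of dimension \<open>s + 1\<close> are not equal, the words of
  \<open>B\<close> that agree there form, after deleting these coordinates, a self-dual code \<open>A\<close>, and \<open>B\<close> is
  generated by the words \<open>(a, w \<bullet> a, w \<bullet> a)\<close> with \<open>a \<in> A\<close> and one word \<open>(w, 1, 0)\<close>. Up to swapping the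
  last two coordinates, \<open>B\<close> depends only on \<open>A\<close> and \<open>w\<close> modulo \<open>A\<close>. Hence two such codes are related by a
  permutation preserving the pair of last coordinates iff some permutation maps \<open>A\<close> to \<open>A'\<close> and
  \<open>w + A\<close> to \<open>w' + A'\<close>; for \<open>A = A'\<close> this is the orbit relation on the vectors \<open>a\<close> that define child
  type codes. A code passes the parent test iff it is related to its canonical representative in
  this way. As the canonical representative itself has unequal last coordinates, every class is
  reached; two equivalent output codes have a common canonical representative, so they have
  equivalent, hence equal, parents and their defining vectors lie in one orbit.
\<close>

section \<open>Binary linear codes and their duals\<close>

text \<open>These two library rules rewrite \<open>+\<close> and \<open>*\<close> on bits to bit operations, which blocks the ring laws.\<close>

declare add_bit_eq_xor [simp del] mult_bit_eq_and [simp del]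

lemma bit_add_self [simp]: "a + a = (0 :: bit)"
  by (cases a) auto

lemma bit_add_self_left [simp]: "a + (a + b) = (b :: bit)"
  by (simp flip: add.assoc)

lemma bit_add_eq_0_iff: "a + b = 0 \<longleftrightarrow> a = (b :: bit)"
  by (cases a; cases b) auto

lemma bit_vec_add_self [simp]: "x \<in> carrier_vec n \<Longrightarrow> x + x = (0\<^sub>v n :: bit vec)"
  by (intro eq_vecI) auto

lemma bit_vec_add_cancel: "x \<in> carrier_vec n \<Longrightarrow> y \<in> carrier_vec n \<Longrightarrow> x + y + y = (x :: bit vec)"
  by (simp add: assoc_add_vec)

text \<open>The only scalars are 0 and 1, and scaling by 0 gives the zero word, so closure under
  scaling follows from containing zero.\<close>

lemma linear_code_iff:
  "linear_code n C \<longleftrightarrow> C \<subseteq> carrier_vec n \<and> 0\<^sub>v n \<in> C \<and> (\<forall>x\<in>C. \<forall>y\<in>C. x + y \<in> C)"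
proof -
  have "c \<cdot>\<^sub>v x \<in> C" if "C \<subseteq> carrier_vec n" "0\<^sub>v n \<in> C" "x \<in> C" for c :: bit and x
  proof (cases c)
    case zero
    moreover have "0 \<cdot>\<^sub>v x = 0\<^sub>v n"
      using that by (intro eq_vecI) auto
    ultimately show ?thesis using that by simp
  qed (use that in auto)
  then show ?thesis
    unfolding linear_code_def VectorSpace.subspace_def submodule_def
    using vec_vs[of n, where 'a = bit] vec_module[of n, where 'a = bit]
    by (auto simp: module_vec_simps)
qed

lemma linear_code_span:
  assumes "S \<subseteq> carrier_vec n"
  shows "linear_code n (code_span n S)"
proof -
  interpret vec_space "TYPE(bit)" n .
  show ?thesis
    using span_is_submodule[of S] assms vec_vs[of n, where 'a = bit]
    by (simp add: linear_code_def VectorSpace.subspace_def)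
qed

lemma code_span_superset:
  assumes "S \<subseteq> carrier_vec n"
  shows "S \<subseteq> code_span n S"
proof -
  interpret vec_space "TYPE(bit)" n .
  show ?thesis
    using in_own_span[of S] assms by simp
qed

lemma code_span_minimal:
  assumes "linear_code n C" and "S \<subseteq> C"
  shows "code_span n S \<subseteq> C"
proof -
  interpret vec_space "TYPE(bit)" n .
  show ?thesis
    using span_is_subset[of S C] assms by (simp add: linear_code_def VectorSpace.subspace_def)
qed

lemma mem_dual_code:
  "v \<in> dual_code n C \<longleftrightarrow> v \<in> carrier_vec n \<and> (\<forall>y\<in>C. v \<bullet> y = 0)"
  by (simp add: dual_code_def vec_module.orthogonal_complement_def)

lemma dual_code_linear:
  assumes "C \<subseteq> carrier_vec n"
  shows "linear_code n (dual_code n C)"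
  unfolding linear_code_iff
proof (intro conjI ballI subsetI)
  fix x y assume "x \<in> dual_code n C" "y \<in> dual_code n C"
  then show "x + y \<in> dual_code n C"
    using assms by (auto simp: mem_dual_code add_scalar_prod_distrib[where n = n] subset_iff)
qed (use assms in \<open>auto simp: mem_dual_code\<close>)

section \<open>Counting the words of a code and of its dual\<close>

lemma bij_betw_vec: "bij_betw (vec n) ({..<n} \<rightarrow>\<^sub>E UNIV) (carrier_vec n)"
  by (intro bij_betw_byWitness[where f' = "\<lambda>v. \<lambda>i\<in>{..<n}. v $ i"])
    (auto simp: PiE_def extensional_def fun_eq_iff)

lemma bit_UNIV: "(UNIV :: bit set) = {0, 1}"
  by auto

lemma card_bit_UNIV: "card (UNIV :: bit set) = 2"
  by (simp add: bit_UNIV)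

lemma finite_bit_vecs: "finite (carrier_vec n :: bit vec set)"
  using bij_betw_finite[OF bij_betw_vec[of n, where 'a = bit]]
  by (simp add: finite_PiE bit_UNIV)

lemma card_bit_vecs: "card (carrier_vec n :: bit vec set) = 2 ^ n"
  using bij_betw_same_card[OF bij_betw_vec[of n, where 'a = bit]]
  by (simp add: card_funcsetE card_bit_UNIV)

lemma linear_code_finite: "linear_code n C \<Longrightarrow> finite C"
  by (metis linear_code_iff finite_bit_vecs finite_subset)

text \<open>Coordinates with respect to a finite basis identify \<open>C\<close> with the bit-valued
  functions on that basis. Taking them in \<open>\<rightarrow>\<^sub>E\<close> makes the coordinate
  function of a word unique.\<close>

lemma card_linear_code:
  assumes "linear_code n C"
  shows "card C = 2 ^ code_dim n C"
proof -
  interpret V: vec_space "TYPE(bit)" n .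
  let ?W = "(module_vec TYPE(bit) n)\<lparr>carrier := C\<rparr>"
  interpret W: vectorspace class_ring ?W
    using V.subspace_is_vs assms by (simp add: linear_code_def)
  have fin: "finite C"
    using assms by (rule linear_code_finite)
  \<comment> \<open>The finite set \<open>C\<close> serves as its own generating set.\<close>
  have "W.fin_dim"
    unfolding W.fin_dim_def
  proof (intro exI conjI)
    show "finite C" "C \<subseteq> carrier ?W" using fin by simp_all
    show "LinearCombinations.module.gen_set class_ring ?W C"
      using W.in_own_span[of C] W.span_is_subset2[of C] by auto
  qed
  then obtain \<beta> where \<beta>: "finite \<beta>" "W.basis \<beta>"
    using W.finite_basis_exists by blast
  have sub: "\<beta> \<subseteq> carrier ?W" using \<beta> by (simp add: W.basis_def)
  have ex1: "\<exists>!a. a \<in> \<beta> \<rightarrow>\<^sub>E UNIV \<and> W.lincomb a \<beta> = v" if "v \<in> C" for v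
    using W.basis_criterion[OF \<beta>(1) sub] \<beta>(2) that by simp
  have "bij_betw (\<lambda>a. W.lincomb a \<beta>) (\<beta> \<rightarrow>\<^sub>E (UNIV :: bit set)) C"
    unfolding bij_betw_def
  proof
    have mem: "W.lincomb a \<beta> \<in> C" for a
      using W.lincomb_closed[OF sub, of a] by simp
    show "inj_on (\<lambda>a. W.lincomb a \<beta>) (\<beta> \<rightarrow>\<^sub>E UNIV)"
      using ex1[OF mem] by (auto intro!: inj_onI)
    show "(\<lambda>a. W.lincomb a \<beta>) ` (\<beta> \<rightarrow>\<^sub>E UNIV) = C"
      using ex1 mem by (fastforce simp: image_iff)
  qed
  then have "card C = card (\<beta> \<rightarrow>\<^sub>E (UNIV :: bit set))"
    by (simp add: bij_betw_same_card)
  also have "\<dots> = 2 ^ W.dim"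
    using \<beta> by (simp add: card_funcsetE card_bit_UNIV W.dim_basis)
  finally show ?thesis
    by (simp add: code_dim_def)
qed

text \<open>The nontrivial character of the additive group of bits. Its values are integers, so that
  the sums below count words without reduction modulo 2.\<close>

definition bit_sign :: "bit \<Rightarrow> int" where
  "bit_sign b = (if b = 0 then 1 else - 1)"

lemma bit_sign_add: "bit_sign (a + b) = bit_sign a * bit_sign b"
  by (cases a; cases b) (auto simp: bit_sign_def)

text \<open>Orthogonality of characters; summing it over all words counts \<open>card C * card (dual_code n C)\<close>.\<close>

lemma sum_bit_sign:
  assumes C: "linear_code n C" and y: "y \<in> carrier_vec n"
  shows "(\<Sum>x\<in>C. bit_sign (y \<bullet> x)) = (if y \<in> dual_code n C then int (card C) else 0)"
proof (cases "y \<in> dual_code n C")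
  case True
  then have "(\<Sum>x\<in>C. bit_sign (y \<bullet> x)) = (\<Sum>x\<in>C. 1)"
    by (intro sum.cong) (auto simp: mem_dual_code bit_sign_def)
  then show ?thesis using True by simp
next
  case False
  then obtain z where z: "z \<in> C" "y \<bullet> z = 1"
    using y by (auto simp: mem_dual_code)
  have cl: "C \<subseteq> carrier_vec n" "\<And>x. x \<in> C \<Longrightarrow> x + z \<in> C"
    using C z by (auto simp: linear_code_iff)
  \<comment> \<open>Translation by \<open>z\<close> permutes \<open>C\<close> and flips every sign
    because \<open>y \<bullet> z = 1\<close>, so the sum equals its own negative.\<close>
  have "(\<Sum>x\<in>C. bit_sign (y \<bullet> x)) = (\<Sum>x\<in>C. bit_sign (y \<bullet> (x + z)))"
    by (rule sum.reindex_bij_witness[where i = "\<lambda>x. x + z" and j = "\<lambda>x. x + z"])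
      (use cl z in \<open>auto simp: bit_vec_add_cancel[where n = n] subset_iff\<close>)
  also have "\<dots> = (\<Sum>x\<in>C. - bit_sign (y \<bullet> x))"
  proof (intro sum.cong refl)
    fix x assume "x \<in> C"
    then have "y \<bullet> (x + z) = y \<bullet> x + y \<bullet> z"
      using cl z y by (intro scalar_prod_add_distrib[where n = n]) auto
    then show "bit_sign (y \<bullet> (x + z)) = - bit_sign (y \<bullet> x)"
      using z by (simp add: bit_sign_add) (simp add: bit_sign_def)
  qed
  finally show ?thesis using False by (simp add: sum_negf)
qed

lemma dual_code_carrier: "dual_code n (carrier_vec n) = {0\<^sub>v n}"
proof -
  have "v = 0\<^sub>v n" if "v \<in> carrier_vec n" "\<forall>y\<in>carrier_vec n. v \<bullet> y = 0" for v :: "bit vec"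
  proof (intro eq_vecI)
    fix i assume i: "i < dim_vec (0\<^sub>v n :: bit vec)"
    then have "v \<bullet> unit_vec n i = v $ i"
      using that by simp
    then show "v $ i = 0\<^sub>v n $ i" using that i by auto
  qed (use that in auto)
  then show ?thesis
    by (auto simp: mem_dual_code)
qed

lemma card_dual_code:
  assumes C: "linear_code n C"
  shows "card C * card (dual_code n C) = 2 ^ n"
proof -
  let ?V = "carrier_vec n :: bit vec set"
  have sub: "C \<subseteq> ?V" and z: "0\<^sub>v n \<in> C" using C by (auto simp: linear_code_iff)
  have V: "linear_code n ?V" by (auto simp: linear_code_iff)
  note fin = finite_bit_vecs[of n] linear_code_finite[OF C]
  have "int (card C * card (dual_code n C)) = (\<Sum>y\<in>dual_code n C. int (card C))"
    by simp
  also have "\<dots> = (\<Sum>y\<in>?V. if y \<in> dual_code n C then int (card C) else 0)"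
    by (intro sum.mono_neutral_cong_left fin) (auto simp: mem_dual_code)
  also have "\<dots> = (\<Sum>y\<in>?V. \<Sum>x\<in>C. bit_sign (y \<bullet> x))"
    by (intro sum.cong) (auto simp: sum_bit_sign[OF C])
  also have "\<dots> = (\<Sum>x\<in>C. \<Sum>y\<in>?V. bit_sign (x \<bullet> y))"
    by (subst sum.swap) (use sub in \<open>auto intro!: sum.cong arg_cong[where f = bit_sign] comm_scalar_prod[where n = n]\<close>)
  \<comment> \<open>Only the zero word is orthogonal to the whole space, so every other inner sum
    vanishes.\<close>
  also have "\<dots> = (\<Sum>x\<in>C. if x = 0\<^sub>v n then 2 ^ n else 0)"
    by (intro sum.cong refl) (use sub in \<open>auto simp: sum_bit_sign[OF V] dual_code_carrier card_bit_vecs subset_iff\<close>)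
  also have "\<dots> = 2 ^ n"
    using fin z by simp
  finally show ?thesis by (metis of_nat_eq_iff of_nat_numeral of_nat_power)
qed

text \<open>A dual is always linear, and \<open>card C * card C = 2 ^ (2 * k)\<close> forces the
  dimension. Below, self-duality is therefore handled as a single equation.\<close>

lemma self_dual_codes_iff: "C \<in> self_dual_codes k \<longleftrightarrow> dual_code (2 * k) C = C"
proof
  assume sd: "dual_code (2 * k) C = C"
  then have "C \<subseteq> carrier_vec (2 * k)" by (auto simp: mem_dual_code)
  then have lin: "linear_code (2 * k) C" using dual_code_linear sd by metis
  have "(2 :: nat) ^ (code_dim (2 * k) C + code_dim (2 * k) C) = 2 ^ (2 * k)"
    using card_dual_code[OF lin] by (simp add: sd card_linear_code[OF lin] power_add)
  then have "code_dim (2 * k) C + code_dim (2 * k) C = 2 * k"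
    by (simp only: power_inject_exp)
  then show "C \<in> self_dual_codes k"
    using sd lin by (simp add: self_dual_codes_def)
qed (simp add: self_dual_codes_def)

section \<open>Coordinate permutations\<close>

lemma perm_word_carrier [simp]: "perm_word n \<sigma> x \<in> carrier_vec n" "dim_vec (perm_word n \<sigma> x) = n"
  by (simp_all add: perm_word_def)

lemma permutes_less: "\<sigma> permutes {..<n} \<Longrightarrow> i < n \<Longrightarrow> \<sigma> i < (n :: nat)"
  by (metis lessThan_iff permutes_in_image)

lemma perm_word_index: "\<sigma> permutes {..<n} \<Longrightarrow> i < n \<Longrightarrow> perm_word n \<sigma> x $ \<sigma> i = x $ i"
  by (simp add: perm_word_def permutes_less permutes_inverses)

text \<open>Comparing entries at the positions \<open>\<sigma> i\<close> keeps the inverse in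
  \<open>perm_word_def\<close> out of most later arguments.\<close>

lemma perm_word_eqI:
  assumes \<sigma>: "\<sigma> permutes {..<n}" and "y \<in> carrier_vec n" "\<And>i. i < n \<Longrightarrow> y $ \<sigma> i = x $ i"
  shows "perm_word n \<sigma> x = y"
proof (intro eq_vecI)
  fix j assume "j < dim_vec y"
  then have "j < n" using assms by simp
  then show "perm_word n \<sigma> x $ j = y $ j"
    using assms(3)[of "Hilbert_Choice.inv \<sigma> j"] permutes_less[OF permutes_inv[OF \<sigma>], of j]
      permutes_inverses(1)[OF \<sigma>, of j] by (simp add: perm_word_def)
qed (use assms in simp)

lemma perm_word_id [simp]: "x \<in> carrier_vec n \<Longrightarrow> perm_word n id x = x"
  by (intro perm_word_eqI) (auto simp: permutes_id)

lemma perm_word_compose: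
  assumes "\<sigma> permutes {..<n}" "\<tau> permutes {..<n}"
  shows "perm_word n (\<sigma> \<circ> \<tau>) x = perm_word n \<sigma> (perm_word n \<tau> x)"
  by (intro perm_word_eqI permutes_compose assms)
    (simp_all add: perm_word_index assms permutes_less)

lemma perm_word_inv:
  assumes "\<sigma> permutes {..<n}" "x \<in> carrier_vec n"
  shows "perm_word n (Hilbert_Choice.inv \<sigma>) (perm_word n \<sigma> x) = x"
    and "perm_word n \<sigma> (perm_word n (Hilbert_Choice.inv \<sigma>) x) = x"
  using assms
  by (simp_all add: permutes_inv permutes_inv_o flip: perm_word_compose)

lemma perm_word_add:
  assumes "\<sigma> permutes {..<n}" "x \<in> carrier_vec n" "y \<in> carrier_vec n"
  shows "perm_word n \<sigma> (x + y) = perm_word n \<sigma> x + perm_word n \<sigma> y"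
  by (intro perm_word_eqI) (use assms in \<open>auto simp: perm_word_index permutes_less\<close>)

lemma perm_word_scalar_prod:
  assumes \<sigma>: "\<sigma> permutes {..<n}" and "x \<in> carrier_vec n" "y \<in> carrier_vec n"
  shows "perm_word n \<sigma> x \<bullet> perm_word n \<sigma> y = x \<bullet> y"
proof -
  have "perm_word n \<sigma> x \<bullet> perm_word n \<sigma> y
      = (\<Sum>i<n. perm_word n \<sigma> x $ i * perm_word n \<sigma> y $ i)"
    by (simp add: scalar_prod_def atLeast0LessThan)
  also have "\<dots> = (\<Sum>i<n. perm_word n \<sigma> x $ \<sigma> i * perm_word n \<sigma> y $ \<sigma> i)"
    by (subst sum.permute[OF \<sigma>]) simp
  also have "\<dots> = x \<bullet> y"
    using assms by (simp add: scalar_prod_def atLeast0LessThan perm_word_index)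
  finally show ?thesis .
qed

lemma perm_code_id: "C \<subseteq> carrier_vec n \<Longrightarrow> perm_code n id C = C"
  by (force simp: perm_code_def subset_iff)

lemma perm_code_compose:
  assumes "\<sigma> permutes {..<n}" "\<tau> permutes {..<n}"
  shows "perm_code n (\<sigma> \<circ> \<tau>) C = perm_code n \<sigma> (perm_code n \<tau> C)"
  using assms by (simp add: perm_code_def image_image perm_word_compose)

lemma perm_code_inv:
  assumes "\<sigma> permutes {..<n}" "C \<subseteq> carrier_vec n"
  shows "perm_code n (Hilbert_Choice.inv \<sigma>) (perm_code n \<sigma> C) = C"
  using assms by (simp add: permutes_inv permutes_inv_o perm_code_id flip: perm_code_compose)

text \<open>Permutations preserve scalar products, so a word orthogonal to the image is pulled back
  by the inverse permutation to a word orthogonal to \<open>C\<close>.\<close>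

lemma dual_perm_code:
  assumes \<sigma>: "\<sigma> permutes {..<n}" and C: "C \<subseteq> carrier_vec n"
  shows "dual_code n (perm_code n \<sigma> C) = perm_code n \<sigma> (dual_code n C)"
proof (intro equalityI subsetI)
  fix v assume v: "v \<in> dual_code n (perm_code n \<sigma> C)"
  let ?u = "perm_word n (Hilbert_Choice.inv \<sigma>) v"
  have cv: "v \<in> carrier_vec n" and orth: "\<And>y. y \<in> C \<Longrightarrow> v \<bullet> perm_word n \<sigma> y = 0"
    using v by (auto simp: mem_dual_code perm_code_def)
  have v_eq: "v = perm_word n \<sigma> ?u" using perm_word_inv(2)[OF \<sigma> cv] by simp
  have "?u \<bullet> y = 0" if "y \<in> C" for y
    using orth[OF that] perm_word_scalar_prod[OF \<sigma>, of ?u y] v_eq C that by auto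
  then have "?u \<in> dual_code n C" by (simp add: mem_dual_code)
  then show "v \<in> perm_code n \<sigma> (dual_code n C)"
    using v_eq by (auto simp: perm_code_def)
next
  fix v assume "v \<in> perm_code n \<sigma> (dual_code n C)"
  then show "v \<in> dual_code n (perm_code n \<sigma> C)"
    using C by (auto simp: perm_code_def mem_dual_code perm_word_scalar_prod[OF \<sigma>] subset_iff)
qed

lemma dual_code_eq_carrier: "dual_code n C = C \<Longrightarrow> C \<subseteq> carrier_vec n"
  by (auto simp: mem_dual_code)

lemma dual_code_antimono: "C \<subseteq> D \<Longrightarrow> dual_code n D \<subseteq> dual_code n C"
  by (auto simp: mem_dual_code subset_iff)

text \<open>Duality reverses inclusions. Several equalities of codes below are obtained from one
  inclusion in this way.\<close>

lemma self_dual_subset_eq: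
  assumes "dual_code n C = C" "dual_code n D = D" "C \<subseteq> D"
  shows "C = D"
  using dual_code_antimono[OF assms(3), of n] assms by simp

lemma self_dual_perm_code:
  "\<sigma> permutes {..<n} \<Longrightarrow> dual_code n C = C \<Longrightarrow> dual_code n (perm_code n \<sigma> C) = perm_code n \<sigma> C"
  by (simp add: dual_perm_code dual_code_eq_carrier)

section \<open>Equivalence of codes, with and without a marked pair of coordinates\<close>

lemma code_equiv_sym:
  assumes "C \<subseteq> carrier_vec n" "code_equiv n C D"
  shows "code_equiv n D C"
proof -
  obtain \<sigma> where "\<sigma> permutes {..<n}" "perm_code n \<sigma> C = D"
    using assms(2) by (auto simp: code_equiv_def)
  then show ?thesis
    unfolding code_equiv_def
    using perm_code_inv[of \<sigma> n C] assms(1) permutes_inv[of \<sigma>] by blast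
qed

lemma code_equiv_trans:
  assumes "code_equiv n C D" "code_equiv n D E"
  shows "code_equiv n C E"
proof -
  obtain \<sigma> \<tau> where "\<sigma> permutes {..<n}" "perm_code n \<sigma> C = D" "\<tau> permutes {..<n}" "perm_code n \<tau> D = E"
    using assms by (auto simp: code_equiv_def)
  then show ?thesis
    unfolding code_equiv_def
    by (intro exI[of _ "\<tau> \<circ> \<sigma>"]) (simp add: perm_code_compose permutes_compose)
qed

text \<open>Here \<open>n\<close> is the length of the parent, so \<open>n\<close> and
  \<open>n + 1\<close> are the two new coordinates. They are preserved only as a set, because the
  parent test compares unordered pairs as well.\<close>

definition pair_equiv :: "nat \<Rightarrow> bcode \<Rightarrow> bcode \<Rightarrow> bool" where
  "pair_equiv n B D \<longleftrightarrow> (\<exists>\<psi>. \<psi> permutes {..<n + 2} \<and> \<psi> ` {n, n + 1} = {n, n + 1} \<and>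
     perm_code (n + 2) \<psi> B = D)"

lemma pair_equiv_sym:
  assumes "B \<subseteq> carrier_vec (n + 2)" "pair_equiv n B D"
  shows "pair_equiv n D B"
proof -
  obtain \<psi> where \<psi>: "\<psi> permutes {..<n + 2}" "\<psi> ` {n, n + 1} = {n, n + 1}"
    "perm_code (n + 2) \<psi> B = D"
    using assms by (auto simp: pair_equiv_def)
  have "Hilbert_Choice.inv \<psi> ` {n, n + 1} = Hilbert_Choice.inv \<psi> ` \<psi> ` {n, n + 1}"
    by (simp only: \<psi>(2))
  also have "\<dots> = {n, n + 1}"
    unfolding image_image permutes_inverses(2)[OF \<psi>(1)] by simp
  finally show ?thesis
    unfolding pair_equiv_def using \<psi>(3) permutes_inv[OF \<psi>(1)] perm_code_inv[OF \<psi>(1) assms(1)] by blast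
qed

lemma pair_equiv_trans:
  assumes "pair_equiv n B D" "pair_equiv n D E"
  shows "pair_equiv n B E"
proof -
  obtain \<sigma> \<tau> where \<sigma>: "\<sigma> permutes {..<n + 2}" "perm_code (n + 2) \<sigma> B = D" "\<sigma> ` {n, n + 1} = {n, n + 1}"
    and \<tau>: "\<tau> permutes {..<n + 2}" "perm_code (n + 2) \<tau> D = E" "\<tau> ` {n, n + 1} = {n, n + 1}"
    using assms unfolding pair_equiv_def by blast
  have "(\<tau> \<circ> \<sigma>) ` {n, n + 1} = {n, n + 1}"
    by (simp only: image_comp[symmetric] \<sigma> \<tau>)
  moreover have "perm_code (n + 2) (\<tau> \<circ> \<sigma>) B = E"
    using \<sigma> \<tau> by (simp only: perm_code_compose)
  ultimately show ?thesis
    unfolding pair_equiv_def using permutes_compose[OF \<sigma>(1) \<tau>(1)] by blast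
qed

lemma pair_equiv_imp_code_equiv: "pair_equiv n B D \<Longrightarrow> code_equiv (n + 2) B D"
  unfolding pair_equiv_def code_equiv_def by blast

section \<open>Extending a self-dual code by two coordinates\<close>

definition pad :: "nat \<Rightarrow> bit vec \<Rightarrow> bit \<Rightarrow> bit \<Rightarrow> bit vec" where
  "pad n u p q = vec (n + 2) (\<lambda>j. if j < n then u $ j else if j = n then p else q)"

lemma pad_simps [simp]:
  "dim_vec (pad n u p q) = n + 2" "pad n u p q \<in> carrier_vec (n + 2)"
  "pad n u p q \<in> carrier_vec (Suc (Suc n))"
  "i < n \<Longrightarrow> pad n u p q $ i = u $ i" "pad n u p q $ n = p" "pad n u p q $ Suc n = q"
  by (auto simp: pad_def)

lemma pad_eqI:
  assumes "v \<in> carrier_vec (n + 2)" "\<And>i. i < n \<Longrightarrow> v $ i = u $ i" "v $ n = p" "v $ Suc n = q"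
  shows "v = pad n u p q"
proof (intro eq_vecI)
  fix i assume "i < dim_vec (pad n u p q)"
  then consider "i < n" | "i = n" | "i = Suc n" by fastforce
  then show "v $ i = pad n u p q $ i" using assms by cases auto
qed (use assms in auto)

lemma pad_inject:
  assumes "u \<in> carrier_vec n" "u' \<in> carrier_vec n"
  shows "pad n u p q = pad n u' p' q' \<longleftrightarrow> u = u' \<and> p = p' \<and> q = q'"
proof
  assume eq: "pad n u p q = pad n u' p' q'"
  have "u $ i = u' $ i" if "i < n" for i
    using arg_cong[OF eq, of "\<lambda>v. v $ i"] that by simp
  then have "u = u'" using assms by (intro eq_vecI) auto
  moreover have "p = p'" "q = q'"
    using arg_cong[OF eq, of "\<lambda>v. v $ n"] arg_cong[OF eq, of "\<lambda>v. v $ Suc n"] by simp_all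
  ultimately show "u = u' \<and> p = p' \<and> q = q'" by simp
qed simp

lemma pad_cases:
  assumes "v \<in> carrier_vec (n + 2)"
  obtains u p q where "u \<in> carrier_vec n" "v = pad n u p q"
proof
  show "v = pad n (vec n (\<lambda>i. v $ i)) (v $ n) (v $ Suc n)"
    using assms by (intro pad_eqI) auto
qed simp

lemma pad_add:
  assumes "u \<in> carrier_vec n" "u' \<in> carrier_vec n"
  shows "pad n u p q + pad n u' p' q' = pad n (u + u') (p + p') (q + q')"
  using assms by (intro pad_eqI) auto

lemma pad_scalar_prod:
  assumes "u \<in> carrier_vec n" "u' \<in> carrier_vec n"
  shows "pad n u p q \<bullet> pad n u' p' q' = u \<bullet> u' + p * p' + q * q'"
  using assms by (simp add: scalar_prod_def)

text \<open>
  For \<open>A\<close> self-dual and \<open>w \<bullet> w = 1\<close>, this is the code generated by \<open>(w, 1, 0)\<close> and the words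
  \<open>(a, w \<bullet> a, w \<bullet> a)\<close> with \<open>a \<in> A\<close>; the membership form avoids generators.
\<close>

definition extension :: "nat \<Rightarrow> bcode \<Rightarrow> bit vec \<Rightarrow> bcode" where
  "extension n A w = {pad n a p q |a p q.
     a \<in> carrier_vec n \<and> w \<bullet> a = p \<and> (if p = q then a else a + w) \<in> A}"

lemma mem_extension:
  "a \<in> carrier_vec n \<Longrightarrow> pad n a p q \<in> extension n A w \<longleftrightarrow>
     w \<bullet> a = p \<and> (if p = q then a else a + w) \<in> A"
  by (auto simp: extension_def pad_inject)

lemma extension_carrier: "extension n A w \<subseteq> carrier_vec (n + 2)"
  by (auto simp: extension_def)

lemma self_dual_add_closed:
  assumes "dual_code n A = A" "x \<in> A" "y \<in> A"
  shows "x + y \<in> A"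
  using dual_code_linear[OF dual_code_eq_carrier[OF assms(1)]] assms by (auto simp: linear_code_iff)

lemma self_dual_orth: "dual_code n A = A \<Longrightarrow> x \<in> A \<Longrightarrow> y \<in> A \<Longrightarrow> x \<bullet> y = 0"
  using mem_dual_code by blast

lemma self_dual_zero: "dual_code n A = A \<Longrightarrow> 0\<^sub>v n \<in> A"
  using dual_code_linear[of A n] dual_code_eq_carrier[of n A] by (auto simp: linear_code_iff)

text \<open>Orthogonality to \<open>(w, 1, 0)\<close> amounts to \<open>w \<bullet> a = p\<close>,
  and orthogonality to the lifts \<open>(u, w \<bullet> u, w \<bullet> u)\<close> of
  \<open>u \<in> A\<close> puts the adjusted first part into the dual of \<open>A\<close>.
  Conversely, the product of two words of the extension equals the product of their adjusted parts,
  which lie in \<open>A\<close>.\<close>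

lemma self_dual_extension:
  assumes A: "dual_code n A = A" and w: "w \<in> carrier_vec n" "w \<bullet> w = 1"
  shows "dual_code (n + 2) (extension n A w) = extension n A w"
proof -
  have cA: "x \<in> carrier_vec n" if "x \<in> A" for x
    using dual_code_eq_carrier[OF A] that by auto
  have "v \<in> dual_code (n + 2) (extension n A w) \<longleftrightarrow> v \<in> extension n A w"
    if cv: "v \<in> carrier_vec (n + 2)" for v
  proof -
    obtain a p q where a: "a \<in> carrier_vec n" and v: "v = pad n a p q"
      using pad_cases[OF cv] by blast
    \<comment> \<open>Adding \<open>(w, 1, 0)\<close> when the last two entries differ makes them
      equal; \<open>?a'\<close> is the first part of the resulting word.\<close>
    let ?a' = "if p = q then a else a + w"
    show ?thesis
    proof
      assume dual: "v \<in> dual_code (n + 2) (extension n A w)"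
      have *: "a \<bullet> u + p * r + q * s = 0" if "u \<in> carrier_vec n" "pad n u r s \<in> extension n A w" for u r s
        using dual that a by (auto simp: mem_dual_code v pad_scalar_prod)
      have "pad n w 1 0 \<in> extension n A w"
        using w self_dual_zero[OF A] by (simp add: mem_extension)
      from *[OF w(1) this] have p: "w \<bullet> a = p"
        using a w by (simp add: bit_add_eq_0_iff comm_scalar_prod[of w n a])
      have "?a' \<in> dual_code n A"
        unfolding mem_dual_code
      proof (intro conjI ballI)
        fix u assume u: "u \<in> A"
        then have "pad n u (w \<bullet> u) (w \<bullet> u) \<in> extension n A w"
          by (simp add: mem_extension cA)
        from *[OF cA[OF u] this] show "?a' \<bullet> u = 0"
          using a w cA[OF u] p
          by (cases p; cases q) (simp_all add: add_scalar_prod_distrib[of a n w u] comm_scalar_prod[of w n u])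
      qed (use a w in auto)
      then show "v \<in> extension n A w"
        unfolding v mem_extension[OF a] using p A by simp
    next
      assume "v \<in> extension n A w"
      then have p: "w \<bullet> a = p" and a': "?a' \<in> A"
        unfolding v mem_extension[OF a] by simp_all
      show "v \<in> dual_code (n + 2) (extension n A w)"
        unfolding mem_dual_code
      proof (intro conjI ballI)
        fix y assume y: "y \<in> extension n A w"
        then obtain u r s where u: "u \<in> carrier_vec n" "y = pad n u r s"
          unfolding extension_def by blast
        let ?u' = "if r = s then u else u + w"
        have r: "w \<bullet> u = r" and u': "?u' \<in> A"
          using y unfolding u(2) mem_extension[OF u(1)] by simp_all
        have "?a' \<bullet> ?u' = 0" using self_dual_orth[OF A a' u'] .
        moreover have "a \<bullet> w = p"
          using p comm_scalar_prod[OF a w(1)] by simp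
        then have "(a + w) \<bullet> u = a \<bullet> u + r" "a \<bullet> (u + w) = a \<bullet> u + p" "(a + w) \<bullet> (u + w) = a \<bullet> u + p + (r + 1)"
          using a u w r by (simp_all add: add_scalar_prod_distrib[of _ n] scalar_prod_add_distrib[of _ n])
        ultimately show "v \<bullet> y = 0"
          unfolding v u pad_scalar_prod[OF a u(1)]
          by (cases p; cases q; cases r; cases s) (simp_all add: add.assoc)
      qed (use cv in auto)
    qed
  qed
  moreover have "dual_code (n + 2) (extension n A w) \<subseteq> carrier_vec (n + 2)"
    by (auto simp: mem_dual_code)
  ultimately show ?thesis
    using extension_carrier[of n A w] by blast
qed

section \<open>How the extension depends on the parent and on the extra word\<close>

lemma perm_word_mem_iff:
  assumes \<sigma>: "\<sigma> permutes {..<n}" and A: "A \<subseteq> carrier_vec n" and x: "x \<in> carrier_vec n"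
  shows "perm_word n \<sigma> x \<in> perm_code n \<sigma> A \<longleftrightarrow> x \<in> A"
proof
  assume "perm_word n \<sigma> x \<in> perm_code n \<sigma> A"
  then obtain y where y: "y \<in> A" "perm_word n \<sigma> x = perm_word n \<sigma> y"
    by (auto simp: perm_code_def)
  then have "x = y"
    using perm_word_inv(1)[OF \<sigma>] A x by (metis subset_iff)
  then show "x \<in> A" using y by simp
qed (simp add: perm_code_def)

text \<open>A permutation of the first \<open>n\<close> coordinates fixes all other numbers, so the
  same function serves at length \<open>n + 2\<close> and fixes both new coordinates.\<close>

lemma pair_equiv_extension_perm:
  assumes \<sigma>: "\<sigma> permutes {..<n}" and A: "A \<subseteq> carrier_vec n" and w: "w \<in> carrier_vec n"
  shows "pair_equiv n (extension n A w) (extension n (perm_code n \<sigma> A) (perm_word n \<sigma> w))"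
proof -
  have \<sigma>2: "\<sigma> permutes {..<n + 2}"
    using permutes_subset[OF \<sigma>] by simp
  have fix_last: "\<sigma> n = n" "\<sigma> (Suc n) = Suc n"
    using permutes_not_in[OF \<sigma>] by simp_all
  have pad: "perm_word (n + 2) \<sigma> (pad n u p q) = pad n (perm_word n \<sigma> u) p q" for u p q
  proof (intro perm_word_eqI \<sigma>2)
    fix i assume "i < n + 2"
    then consider "i < n" | "i = n" | "i = Suc n" by fastforce
    then show "pad n (perm_word n \<sigma> u) p q $ \<sigma> i = pad n u p q $ i"
      by cases (simp_all add: fix_last perm_word_index[OF \<sigma>] permutes_less[OF \<sigma>])
  qed simp
  have mem: "pad n (perm_word n \<sigma> a) p q \<in> extension n (perm_code n \<sigma> A) (perm_word n \<sigma> w)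
      \<longleftrightarrow> pad n a p q \<in> extension n A w" if a: "a \<in> carrier_vec n" for a p q
    using perm_word_mem_iff[OF \<sigma> A, of a] perm_word_mem_iff[OF \<sigma> A, of "a + w"] a w
    by (cases "p = q") (simp_all add: mem_extension perm_word_scalar_prod[OF \<sigma>] perm_word_add[OF \<sigma>])
  have "perm_code (n + 2) \<sigma> (extension n A w) = extension n (perm_code n \<sigma> A) (perm_word n \<sigma> w)"
  proof (intro equalityI subsetI)
    fix v assume "v \<in> perm_code (n + 2) \<sigma> (extension n A w)"
    then obtain x where x: "x \<in> extension n A w" "v = perm_word (n + 2) \<sigma> x"
      unfolding perm_code_def by blast
    then obtain a p q where "a \<in> carrier_vec n" "x = pad n a p q"
      unfolding extension_def by blast
    then show "v \<in> extension n (perm_code n \<sigma> A) (perm_word n \<sigma> w)"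
      using x by (simp only: pad mem)
  next
    fix v assume v: "v \<in> extension n (perm_code n \<sigma> A) (perm_word n \<sigma> w)"
    then obtain a p q where a: "a \<in> carrier_vec n" "v = pad n a p q"
      unfolding extension_def by blast
    let ?b = "perm_word n (Hilbert_Choice.inv \<sigma>) a"
    have "pad n ?b p q \<in> extension n A w"
      using v a mem[of ?b] perm_word_inv(2)[OF \<sigma> a(1)] by simp
    moreover have "v = perm_word (n + 2) \<sigma> (pad n ?b p q)"
      using a pad perm_word_inv(2)[OF \<sigma> a(1)] by simp
    ultimately show "v \<in> perm_code (n + 2) \<sigma> (extension n A w)"
      unfolding perm_code_def by blast
  qed
  then show ?thesis
    unfolding pair_equiv_def using \<sigma>2 fix_last by auto
qed

text \<open>
  For \<open>v \<in> A\<close>, replacing \<open>w\<close> by \<open>w + v\<close> changes the extension only by swapping the last two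
  coordinates, and only if \<open>w \<bullet> v = 1\<close>.
\<close>

lemma pair_equiv_extension_translate:
  assumes A: "dual_code n A = A" and w: "w \<in> carrier_vec n" "w \<bullet> w = 1" and v: "v \<in> A"
  shows "pair_equiv n (extension n A w) (extension n A (w + v))"
proof -
  note sp = scalar_prod_add_distrib[where n = n] add_scalar_prod_distrib[where n = n]
  have cv: "v \<in> carrier_vec n" using v dual_code_eq_carrier[OF A] by auto
  have vv: "v \<bullet> v = 0" using self_dual_orth[OF A v v] .
  have wv1: "(w + v) \<bullet> (w + v) = 1"
    using w cv vv by (simp add: sp comm_scalar_prod[of v n w])
  \<comment> \<open>If \<open>p = q\<close>, then \<open>a \<in> A\<close> and
    \<open>v \<bullet> a = 0\<close>, so nothing changes. Otherwise \<open>a + w \<in> A\<close>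
    gives \<open>v \<bullet> a = w \<bullet> v\<close>, which is the amount by which the entry at
    \<open>n\<close> has to change.\<close>
  have swap: "if w \<bullet> v = 0 then pad n a p q \<in> extension n A (w + v) else pad n a q p \<in> extension n A (w + v)"
    if a: "a \<in> carrier_vec n" "pad n a p q \<in> extension n A w" for a p q
  proof (cases "p = q")
    case True
    then have "a \<in> A" "w \<bullet> a = p" using a by (simp_all add: mem_extension)
    moreover from this have "v \<bullet> a = 0" using self_dual_orth[OF A v] by simp
    ultimately show ?thesis
      using a w cv True by (simp add: mem_extension sp)
  next
    case False
    then have aw: "a + w \<in> A" "w \<bullet> a = p" using a by (simp_all add: mem_extension)
    then have "v \<bullet> (a + w) = 0" using self_dual_orth[OF A v] by simp
    then have va: "v \<bullet> a = w \<bullet> v"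
      using a w cv by (simp add: sp bit_add_eq_0_iff comm_scalar_prod[of w n v])
    have "a + w + v \<in> A" using self_dual_add_closed[OF A aw(1) v] .
    then have awv: "a + (w + v) \<in> A" using a w cv by (simp add: assoc_add_vec)
    have "(w + v) \<bullet> a = p + w \<bullet> v"
      using a w cv aw(2) va by (simp add: sp)
    then show ?thesis
      using a False awv by (cases p; cases q; cases "w \<bullet> v") (simp_all add: mem_extension)
  qed
  define \<tau> where "\<tau> = (if w \<bullet> v = 0 then id else transpose n (Suc n))"
  have \<tau>: "\<tau> permutes {..<n + 2}"
    by (auto simp: \<tau>_def permutes_id intro!: permutes_swap_id)
  have pad: "perm_word (n + 2) \<tau> (pad n a p q) = (if w \<bullet> v = 0 then pad n a p q else pad n a q p)" for a p q
  proof (intro perm_word_eqI \<tau>)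
    fix i assume "i < n + 2"
    then consider "i < n" | "i = n" | "i = Suc n" by fastforce
    then show "(if w \<bullet> v = 0 then pad n a p q else pad n a q p) $ \<tau> i = pad n a p q $ i"
      by cases (auto simp: \<tau>_def transpose_def)
  qed simp
  have "perm_code (n + 2) \<tau> (extension n A w) \<subseteq> extension n A (w + v)"
  proof
    fix x assume "x \<in> perm_code (n + 2) \<tau> (extension n A w)"
    then obtain y where y: "y \<in> extension n A w" "x = perm_word (n + 2) \<tau> y"
      unfolding perm_code_def by blast
    then obtain a p q where "a \<in> carrier_vec n" "y = pad n a p q"
      unfolding extension_def by blast
    with y show "x \<in> extension n A (w + v)"
      using swap[of a p q] by (simp only: pad) (simp split: if_splits)
  qed
  then have "perm_code (n + 2) \<tau> (extension n A w) = extension n A (w + v)"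
    using self_dual_subset_eq[OF self_dual_perm_code[OF \<tau> self_dual_extension[OF A w]]
        self_dual_extension[OF A _ wv1]] w cv by simp
  moreover have "\<tau> ` {n, n + 1} = {n, n + 1}"
    by (auto simp: \<tau>_def)
  ultimately show ?thesis
    unfolding pair_equiv_def using \<tau> by blast
qed

lemma pair_equiv_extension_translate':
  assumes A: "dual_code n A = A" and w: "w \<in> carrier_vec n" "w \<bullet> w = 1"
    and w': "w' \<in> carrier_vec n" "w + w' \<in> A"
  shows "pair_equiv n (extension n A w) (extension n A w')"
proof -
  have "w + (w + w') = w'"
    using w w' by (intro eq_vecI) auto
  then show ?thesis
    using pair_equiv_extension_translate[OF A w w'(2)] by simp
qed

text \<open>The parent can be read off from the words whose last two entries agree, and a swap of
  these entries does not affect such words. Hence the permutation restricts to one that maps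
  \<open>A\<close> to \<open>A'\<close> and carries the functional of \<open>w\<close> on
  \<open>A\<close> to that of \<open>w'\<close> on \<open>A'\<close>. The difference of the two
  words thus annihilates \<open>A'\<close> and lies in its dual, which is \<open>A'\<close>.\<close>

lemma pair_equiv_extension_imp:
  assumes A: "dual_code n A = A" and A': "dual_code n A' = A'"
    and w: "w \<in> carrier_vec n" "w' \<in> carrier_vec n"
    and equiv: "pair_equiv n (extension n A w) (extension n A' w')"
  obtains \<sigma> where "\<sigma> permutes {..<n}" "perm_code n \<sigma> A = A'" "perm_word n \<sigma> w + w' \<in> A'"
proof -
  obtain \<psi> where \<psi>: "\<psi> permutes {..<n + 2}" "\<psi> ` {n, n + 1} = {n, n + 1}"
    "perm_code (n + 2) \<psi> (extension n A w) = extension n A' w'"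
    using equiv unfolding pair_equiv_def by blast
  have last: "\<psi> n \<in> {n, n + 1}" "\<psi> (n + 1) \<in> {n, n + 1}"
    using \<psi>(2) by blast+
  have less: "\<psi> i < n" if "i < n" for i
  proof -
    have "\<psi> i \<notin> \<psi> ` {n, n + 1}"
      using that permutes_inj[OF \<psi>(1)] by (auto simp: inj_eq)
    then have "\<psi> i \<notin> {n, n + 1}" by (simp only: \<psi>(2) not_False_eq_True)
    moreover have "\<psi> i < n + 2"
      using permutes_less[OF \<psi>(1)] that by simp
    ultimately show ?thesis by simp
  qed
  \<comment> \<open>The restriction of \<open>\<psi>\<close> to the old coordinates; the value
    \<open>i\<close> elsewhere is what \<open>permutes\<close> demands.\<close>
  define \<sigma> where "\<sigma> i = (if i < n then \<psi> i else i)" for i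
  have "inj_on \<sigma> {..<n}"
    by (intro inj_onI) (simp add: \<sigma>_def inj_eq[OF permutes_inj[OF \<psi>(1)]])
  moreover have "\<sigma> ` {..<n} \<subseteq> {..<n}"
    using less by (auto simp: \<sigma>_def)
  ultimately have "bij_betw \<sigma> {..<n} {..<n}"
    unfolding bij_betw_def using endo_inj_surj[of "{..<n}" \<sigma>] by simp
  then have \<sigma>: "\<sigma> permutes {..<n}"
    by (rule bij_imp_permutes) (simp add: \<sigma>_def)
  have pad: "perm_word (n + 2) \<psi> (pad n u t t) = pad n (perm_word n \<sigma> u) t t" for u t
  proof (intro perm_word_eqI \<psi>(1))
    fix i assume "i < n + 2"
    then consider "i < n" | "i = n" | "i = n + 1" by fastforce
    then show "pad n (perm_word n \<sigma> u) t t $ \<psi> i = pad n u t t $ i"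
    proof cases
      case 1
      then show ?thesis
        using less[OF 1] perm_word_index[OF \<sigma> 1, of u] by (simp add: \<sigma>_def)
    qed (use last in auto)
  qed simp
  have cA: "u \<in> carrier_vec n" if "u \<in> A" for u using that dual_code_eq_carrier[OF A] by auto
  have image: "perm_word n \<sigma> u \<in> A'" "w \<bullet> u = w' \<bullet> perm_word n \<sigma> u" if "u \<in> A" for u
  proof -
    have "pad n u (w \<bullet> u) (w \<bullet> u) \<in> extension n A w"
      using that by (simp add: mem_extension cA)
    then have "pad n (perm_word n \<sigma> u) (w \<bullet> u) (w \<bullet> u) \<in> extension n A' w'"
      unfolding pad[symmetric] \<psi>(3)[symmetric] by (simp add: perm_code_def)
    then show "perm_word n \<sigma> u \<in> A'" "w \<bullet> u = w' \<bullet> perm_word n \<sigma> u"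
      by (simp_all add: mem_extension)
  qed
  have eq: "perm_code n \<sigma> A = A'"
    using self_dual_subset_eq[OF self_dual_perm_code[OF \<sigma> A] A'] image(1)
    by (auto simp: perm_code_def)
  have "perm_word n \<sigma> w + w' \<in> dual_code n A'"
    unfolding mem_dual_code
  proof (intro conjI ballI)
    fix y assume "y \<in> A'"
    then obtain u where u: "u \<in> A" "y = perm_word n \<sigma> u"
      using eq by (auto simp: perm_code_def)
    then show "(perm_word n \<sigma> w + w') \<bullet> y = 0"
      using w image(2)[OF u(1)] cA[OF u(1)]
      by (simp add: add_scalar_prod_distrib[where n = n] perm_word_scalar_prod[OF \<sigma>])
  qed (use w in simp)
  then show ?thesis using that \<sigma> eq A' by simp
qed

text \<open>Over bits \<open>y \<bullet> y\<close> is the sum of the entries of \<open>y\<close>, so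
  the all-one word \<open>j\<close> is orthogonal to every self-orthogonal word and lies in
  \<open>B\<close>. Adding it turns a word ending in \<open>(0, 1)\<close> into one ending in
  \<open>(1, 0)\<close>.\<close>

lemma self_dual_obtain_pad_1_0:
  assumes B: "dual_code (n + 2) B = B" and ne: "\<not> equal_coords B n (n + 1)"
  obtains w where "w \<in> carrier_vec n" "pad n w 1 0 \<in> B"
proof -
  have cB: "v \<in> carrier_vec (n + 2)" if "v \<in> B" for v
    using that dual_code_eq_carrier[OF B] by auto
  obtain v where v: "v \<in> B" "v $ n \<noteq> v $ (n + 1)"
    using ne by (auto simp: equal_coords_def)
  then obtain u p q where u: "u \<in> carrier_vec n" "v = pad n u p q"
    using pad_cases cB by metis
  define j where "j = pad n (vec n (\<lambda>_. 1)) 1 1"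
  have "j \<in> dual_code (n + 2) B"
    unfolding mem_dual_code
  proof (intro conjI ballI)
    fix y assume y: "y \<in> B"
    have j1: "j $ i = 1" if "i < n + 2" for i
      using that by (auto simp: j_def pad_def)
    have "b * b = b" for b :: bit
      by (cases b) auto
    then have "j \<bullet> y = y \<bullet> y"
      unfolding scalar_prod_def using cB[OF y] j1 by (intro sum.cong) auto
    then show "j \<bullet> y = 0" using self_dual_orth[OF B y y] by simp
  qed (simp add: j_def)
  then have "v + j \<in> B"
    using B v(1) self_dual_add_closed[OF B v(1), of j] by simp
  moreover have "v + j = pad n (u + vec n (\<lambda>_. 1)) (p + 1) (q + 1)"
    using u by (simp add: j_def pad_add)
  ultimately show ?thesis
    using that[of u] that[of "u + vec n (\<lambda>_. 1)"] u v by (cases p; cases q) auto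
qed

text \<open>\<open>A\<close> consists of the words of \<open>B\<close> with equal last entries,
  after deleting these. The fact \<open>fold\<close> shows that every word of \<open>B\<close> meets
  the membership condition of the extension: one half is orthogonality to \<open>(w, 1, 0)\<close>,
  the other comes from adding that word.\<close>

lemma self_dual_eq_extension:
  assumes B: "dual_code (n + 2) B = B" and ne: "\<not> equal_coords B n (n + 1)"
  obtains A w where "dual_code n A = A" "w \<in> carrier_vec n" "w \<bullet> w = 1" "B = extension n A w"
proof -
  obtain w where w: "w \<in> carrier_vec n" "pad n w 1 0 \<in> B"
    using self_dual_obtain_pad_1_0[OF B ne] by blast
  note sp = scalar_prod_add_distrib[where n = n] comm_scalar_prod[of w n]
  have ww: "w \<bullet> w = 1"
    using self_dual_orth[OF B w(2) w(2)] w(1) by (simp add: pad_scalar_prod bit_add_eq_0_iff)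
  define A where "A = {u \<in> carrier_vec n. \<exists>t. pad n u t t \<in> B}"
  have fold: "(if p = q then a else a + w) \<in> A" "w \<bullet> a = p" if a: "a \<in> carrier_vec n" "pad n a p q \<in> B" for a p q
  proof -
    show "w \<bullet> a = p"
      using self_dual_orth[OF B w(2) a(2)] w(1) a(1) by (simp add: pad_scalar_prod bit_add_eq_0_iff)
    have "pad n (a + w) (p + 1) q \<in> B"
      using self_dual_add_closed[OF B a(2) w(2)] a w by (simp add: pad_add)
    then show "(if p = q then a else a + w) \<in> A"
      using a w unfolding A_def by (cases p; cases q) auto
  qed
  have A: "dual_code n A = A"
  proof (intro equalityI subsetI)
    fix x assume x: "x \<in> dual_code n A"
    then have cx: "x \<in> carrier_vec n" by (simp add: mem_dual_code)
    \<comment> \<open>A word in the dual of \<open>A\<close> is lifted with the only last entries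
      that make it orthogonal to \<open>(w, 1, 0)\<close>.\<close>
    have "pad n x (w \<bullet> x) (w \<bullet> x) \<in> dual_code (n + 2) B"
      unfolding mem_dual_code
    proof (intro conjI ballI)
      fix b assume b: "b \<in> B"
      then obtain a p q where a: "a \<in> carrier_vec n" "b = pad n a p q"
        using pad_cases dual_code_eq_carrier[OF B] by (metis subset_iff)
      have "x \<bullet> (if p = q then a else a + w) = 0"
        using x fold(1)[of a p q] a b by (simp only: mem_dual_code)
      moreover have "x \<bullet> (a + w) = x \<bullet> a + w \<bullet> x"
        using a cx w by (simp add: sp)
      ultimately show "pad n x (w \<bullet> x) (w \<bullet> x) \<bullet> b = 0"
        unfolding a(2) pad_scalar_prod[OF cx a(1)] by (cases p; cases q) (simp_all add: add.assoc)
    qed simp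
    then show "x \<in> A" using B cx by (auto simp: A_def)
  next
    fix x assume "x \<in> A"
    then obtain t where x: "x \<in> carrier_vec n" "pad n x t t \<in> B" by (auto simp: A_def)
    have "x \<bullet> y = 0" if "y \<in> A" for y
    proof -
      obtain s where y: "y \<in> carrier_vec n" "pad n y s s \<in> B" using \<open>y \<in> A\<close> by (auto simp: A_def)
      show ?thesis
        using self_dual_orth[OF B x(2) y(2)] x y by (simp add: pad_scalar_prod add.assoc)
    qed
    then show "x \<in> dual_code n A" using x by (simp add: mem_dual_code)
  qed
  have "B \<subseteq> extension n A w"
  proof
    fix b assume b: "b \<in> B"
    then obtain a p q where a: "a \<in> carrier_vec n" "b = pad n a p q"
      using pad_cases dual_code_eq_carrier[OF B] by (metis subset_iff)
    then show "b \<in> extension n A w"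
      using fold[of a p q] b by (simp only: mem_extension)
  qed
  then have "B = extension n A w"
    using self_dual_subset_eq[OF B self_dual_extension[OF A w(1) ww]] by simp
  then show ?thesis using that A w ww by blast
qed

section \<open>Child type codes\<close>

definition info_word :: "nat \<Rightarrow> nat set \<Rightarrow> bit vec \<Rightarrow> bit vec" where
  "info_word n I a = vec n (\<lambda>j. if j \<in> I then a $ card {l \<in> I. l < j} else 0)"

lemma info_word_carrier [simp]: "info_word n I a \<in> carrier_vec n" "dim_vec (info_word n I a) = n"
  by (simp_all add: info_word_def)

lemma child_word_eq: "child_word m I a = pad (2 * m) (info_word (2 * m) I a) 1 0"
  by (intro pad_eqI) (simp_all add: child_word_def info_word_def)

lemma row_extended_generator:
  assumes "G \<in> carrier_mat m (2 * m)" "i < m"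
  shows "row (extended_generator m G a) i = pad (2 * m) (row G i) (a $ i) (a $ i)"
  using assms by (intro pad_eqI) (simp_all add: extended_generator_def)

section \<open>Permutation matrices acting on rows and columns\<close>

lemma mult_perm_mat_row:
  assumes "G \<in> carrier_mat m n" "i < m" "\<sigma> permutes {..<n}"
  shows "row (G * perm_mat n \<sigma>) i = perm_word n \<sigma> (row G i)"
proof (intro eq_vecI)
  fix j assume "j < dim_vec (perm_word n \<sigma> (row G i))"
  then have j: "j < n" by simp
  have eq: "\<sigma> k = j \<longleftrightarrow> k = Hilbert_Choice.inv \<sigma> j" for k
    using permutes_inv_eq[OF assms(3), of j k] by auto
  have "row (G * perm_mat n \<sigma>) i $ j = (\<Sum>k\<in>{0..<n}. G $$ (i, k) * (if \<sigma> k = j then 1 else 0))"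
    using assms j by (simp add: perm_mat_def scalar_prod_def)
  also have "\<dots> = (\<Sum>k\<in>{0..<n}. if k = Hilbert_Choice.inv \<sigma> j then G $$ (i, k) else 0)"
    by (intro sum.cong) (auto simp: eq)
  also have "\<dots> = perm_word n \<sigma> (row G i) $ j"
    using j assms permutes_less[OF permutes_inv[OF assms(3)] j] by (simp add: perm_word_def)
  finally show "row (G * perm_mat n \<sigma>) i $ j = perm_word n \<sigma> (row G i) $ j" .
qed (use assms in \<open>simp add: perm_mat_def\<close>)

lemma perm_mat_carrier [simp]: "perm_mat n \<sigma> \<in> carrier_mat n n"
  by (simp add: perm_mat_def)

text \<open>Acting on a column amounts to acting on a row by the transpose, which is the inverse
  permutation matrix. This is the source of the inverses in the orbit argument.\<close>

lemma perm_mat_mult_vec: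
  assumes "\<sigma> permutes {..<n}" "w \<in> carrier_vec n"
  shows "perm_mat n \<sigma> *\<^sub>v w = perm_word n (Hilbert_Choice.inv \<sigma>) w"
proof (intro eq_vecI)
  fix i assume "i < dim_vec (perm_word n (Hilbert_Choice.inv \<sigma>) w)"
  then have i: "i < n" by simp
  have "(perm_mat n \<sigma> *\<^sub>v w) $ i = (\<Sum>j\<in>{0..<n}. (if \<sigma> i = j then 1 else 0) * w $ j)"
    using assms i by (simp add: perm_mat_def scalar_prod_def)
  also have "\<dots> = (\<Sum>j\<in>{0..<n}. if \<sigma> i = j then w $ j else 0)"
    by (intro sum.cong) auto
  also have "\<dots> = perm_word n (Hilbert_Choice.inv \<sigma>) w $ i"
    using i permutes_less[OF assms(1) i] by (simp add: perm_word_def permutes_inv_inv[OF assms(1)])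
  finally show "(perm_mat n \<sigma> *\<^sub>v w) $ i = perm_word n (Hilbert_Choice.inv \<sigma>) w $ i" .
qed (simp add: perm_mat_def)

lemma perm_mat_inverse:
  assumes "\<sigma> permutes {..<n}"
  shows "perm_mat n \<sigma> * perm_mat n (Hilbert_Choice.inv \<sigma>) = 1\<^sub>m n"
proof (intro eq_rowI)
  fix i assume "i < dim_row (1\<^sub>m n)"
  then have i: "i < n" by simp
  have "row (perm_mat n \<sigma>) i = perm_word n \<sigma> (unit_vec n i)"
    using mult_perm_mat_row[of "1\<^sub>m n" n n i \<sigma>] i assms by (simp add: left_mult_one_mat[of _ n n])
  then show "row (perm_mat n \<sigma> * perm_mat n (Hilbert_Choice.inv \<sigma>)) i = row (1\<^sub>m n) i"
    using i assms by (simp add: mult_perm_mat_row[of _ n n] permutes_inv perm_word_inv del: row_mult)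
qed (simp_all add: perm_mat_def)

lemma Aut_inv:
  assumes "\<sigma> \<in> Aut n A" "A \<subseteq> carrier_vec n"
  shows "Hilbert_Choice.inv \<sigma> \<in> Aut n A"
  using assms perm_code_inv[of \<sigma> n A] by (simp add: Aut_def permutes_inv)

section \<open>Self-dual codes with a systematic generator matrix\<close>

context
  fixes m :: nat and A :: bcode and G :: "bit mat" and I :: "nat set"
  assumes gen: "systematic_generator m A G I" and sd: "dual_code (2 * m) A = A"
begin

lemma G_carrier: "G \<in> carrier_mat m (2 * m)"
  and info_set: "I \<subseteq> {..<2 * m}" "card I = m"
  and span_rows: "code_span (2 * m) (set (rows G)) = A"
  and submatrix_info: "submatrix G UNIV I = 1\<^sub>m m"
  using gen by (simp_all add: systematic_generator_def)

lemma rows_G_carrier: "set (rows G) \<subseteq> carrier_vec (2 * m)"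
  using G_carrier rows_carrier[of G] by simp

lemma row_mem: "i < m \<Longrightarrow> row G i \<in> A"
  using code_span_superset[OF rows_G_carrier] G_carrier
  by (auto simp flip: span_rows simp: rows_def)

lemma pick_info: "i < m \<Longrightarrow> pick I i \<in> I" "i < m \<Longrightarrow> pick I i < 2 * m"
  "i < m \<Longrightarrow> card {l \<in> I. l < pick I i} = i"
  using pick_in_set_le[of i I] card_pick_le[of i I] info_set by auto

text \<open>\<open>pick I i\<close> is the information position of rank \<open>i\<close>, counted
  from 0. The inverse map is the rank function that occurs in \<open>child_word\<close>.\<close>

lemma bij_betw_pick: "bij_betw (pick I) {..<m} I"
proof (intro bij_betw_byWitness[where f' = "\<lambda>j. card {l \<in> I. l < j}"])
  have fin: "finite I" using info_set(1) finite_subset by blast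
  show "\<forall>j\<in>I. pick I (card {l \<in> I. l < j}) = j"
    using pick_card_in_set by auto
  show "(\<lambda>j. card {l \<in> I. l < j}) ` I \<subseteq> {..<m}"
  proof safe
    fix j assume "j \<in> I"
    then have "card {l \<in> I. l < j} < card I"
      using fin by (intro psubset_card_mono) auto
    then show "card {l \<in> I. l < j} < m" using info_set by simp
  qed
qed (use pick_info in auto)

lemma G_pick:
  assumes "k < m" "i < m"
  shows "G $$ (k, pick I i) = (if k = i then 1 else 0)"
proof -
  have "{j. j < dim_col G \<and> j \<in> I} = I" "{j. j < dim_row G \<and> j \<in> UNIV} = {..<m}"
    using G_carrier info_set by auto
  then have "submatrix G UNIV I $$ (k, i) = G $$ (pick UNIV k, pick I i)"
    using assms info_set by (intro submatrix_index) simp_all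
  then show ?thesis
    using assms by (simp add: submatrix_info pick_UNIV)
qed

text \<open>The entries of a word at the information positions are its coefficients in the rows of
  \<open>G\<close>. The words \<open>?L\<close> with this property form a linear code containing the
  rows, hence all of \<open>A\<close>.\<close>

lemma code_expand:
  assumes "u \<in> A" "k < 2 * m"
  shows "u $ k = (\<Sum>i<m. u $ pick I i * G $$ (i, k))"
proof -
  let ?L = "{u \<in> carrier_vec (2 * m). \<forall>k<2 * m. u $ k = (\<Sum>i<m. u $ pick I i * G $$ (i, k))}"
  have "linear_code (2 * m) ?L"
    unfolding linear_code_iff
  proof (intro conjI ballI)
    fix x y assume xy: "x \<in> ?L" "y \<in> ?L"
    have "(x + y) $ k = (\<Sum>i<m. (x + y) $ pick I i * G $$ (i, k))" if "k < 2 * m" for k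
    proof -
      have c: "x \<in> carrier_vec (2 * m)" "y \<in> carrier_vec (2 * m)"
        and e: "x $ k = (\<Sum>i<m. x $ pick I i * G $$ (i, k))" "y $ k = (\<Sum>i<m. y $ pick I i * G $$ (i, k))"
        using xy that by blast+
      have "(\<Sum>i<m. (x + y) $ pick I i * G $$ (i, k))
          = (\<Sum>i<m. x $ pick I i * G $$ (i, k) + y $ pick I i * G $$ (i, k))"
        using c by (intro sum.cong refl) (simp add: pick_info(2) distrib_right)
      also have "\<dots> = x $ k + y $ k"
        by (simp only: sum.distrib e)
      finally show ?thesis using c that by simp
    qed
    then show "x + y \<in> ?L" using xy by simp
  qed (auto simp: pick_info(2))
  moreover have "set (rows G) \<subseteq> ?L"
  proof
    fix u assume "u \<in> set (rows G)"
    then obtain r where r: "r < m" "u = row G r"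
      using G_carrier by (auto simp: rows_def)
    have "row G r $ k = (\<Sum>i<m. row G r $ pick I i * G $$ (i, k))" if "k < 2 * m" for k
    proof -
      have "(\<Sum>i<m. row G r $ pick I i * G $$ (i, k)) = (\<Sum>i<m. if r = i then G $$ (i, k) else 0)"
        using r G_carrier by (intro sum.cong) (auto simp: pick_info(2) G_pick)
      then show ?thesis using r that G_carrier by simp
    qed
    then show "u \<in> ?L" using r G_carrier by auto
  qed
  ultimately have "code_span (2 * m) (set (rows G)) \<subseteq> ?L"
    by (rule code_span_minimal)
  then have "A \<subseteq> ?L" by (simp only: span_rows)
  then show ?thesis using assms by blast
qed

lemma info_word_scalar_prod:
  assumes "v \<in> carrier_vec (2 * m)"
  shows "info_word (2 * m) I a \<bullet> v = (\<Sum>i<m. a $ i * v $ pick I i)"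
proof -
  have "info_word (2 * m) I a \<bullet> v
      = (\<Sum>j\<in>{0..<2 * m}. if j \<in> I then a $ card {l \<in> I. l < j} * v $ j else 0)"
    using assms unfolding scalar_prod_def by (intro sum.cong) (auto simp: info_word_def)
  also have "\<dots> = (\<Sum>j\<in>I. a $ card {l \<in> I. l < j} * v $ j)"
    using info_set by (intro sum.mono_neutral_cong_right) auto
  also have "\<dots> = (\<Sum>i<m. a $ card {l \<in> I. l < pick I i} * v $ pick I i)"
    by (rule sum.reindex_bij_betw[OF bij_betw_pick, symmetric])
  also have "\<dots> = (\<Sum>i<m. a $ i * v $ pick I i)"
    by (intro sum.cong) (auto simp: pick_info)
  finally show ?thesis .
qed

text \<open>The columns of \<open>G\<close> at the information positions form the identity matrix
  and \<open>info_word\<close> vanishes elsewhere, so it is a right inverse of multiplication by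
  \<open>G\<close>.\<close>

lemma mult_info_word:
  assumes "a \<in> carrier_vec m"
  shows "G *\<^sub>v info_word (2 * m) I a = a"
proof (intro eq_vecI)
  fix k assume "k < dim_vec a"
  then have k: "k < m" using assms by simp
  have "(G *\<^sub>v info_word (2 * m) I a) $ k = info_word (2 * m) I a \<bullet> row G k"
    using k G_carrier comm_scalar_prod[of "row G k" "2 * m" "info_word (2 * m) I a"] by simp
  also have "\<dots> = (\<Sum>i<m. a $ i * row G k $ pick I i)"
    using k G_carrier by (intro info_word_scalar_prod) simp
  also have "\<dots> = (\<Sum>i<m. if k = i then a $ i else 0)"
    using k G_carrier by (intro sum.cong refl) (simp add: pick_info(2) G_pick)
  finally show "(G *\<^sub>v info_word (2 * m) I a) $ k = a $ k" using k by simp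
qed (use assms G_carrier in simp)

text \<open>Over bits the product of a word with itself is the parity of its weight. Odd weight of
  \<open>a\<close> is thus the hypothesis \<open>w \<bullet> w = 1\<close> of the extension
  lemmas.\<close>

lemma info_word_norm:
  assumes "a \<in> carrier_vec m"
  shows "info_word (2 * m) I a \<bullet> info_word (2 * m) I a = 1 \<longleftrightarrow> a \<in> odd_weight_vecs m"
proof -
  have of_nat: "of_nat k = (if even k then 0 else 1 :: bit)" for k
    by (induct k) auto
  have "info_word (2 * m) I a \<bullet> info_word (2 * m) I a = (\<Sum>i<m. a $ i * a $ i)"
    by (subst info_word_scalar_prod) (auto simp: info_word_def pick_info intro!: sum.cong)
  also have "\<dots> = (\<Sum>i<m. if a $ i = 1 then 1 else 0)"
    by (intro sum.cong) auto
  also have "\<dots> = (\<Sum>i\<in>{i. i < m \<and> a $ i = 1}. 1)"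
    by (intro sum.mono_neutral_cong_right) auto
  also have "\<dots> = of_nat (card {i. i < m \<and> a $ i = 1})" by simp
  finally show ?thesis
    using assms by (simp add: of_nat odd_weight_vecs_def)
qed

text \<open>Since \<open>A\<close> is its own dual, \<open>G\<close> is also a parity check matrix,
  and cosets of \<open>A\<close> are distinguished by their syndromes.\<close>

lemma mem_code_if_mult_eq:
  assumes "v \<in> carrier_vec (2 * m)" "w \<in> carrier_vec (2 * m)"
  shows "v + w \<in> A \<longleftrightarrow> G *\<^sub>v v = G *\<^sub>v w"
proof -
  have "A = dual_code (2 * m) (set (rows G))"
    using vec_space.in_orthogonal_complement_span[OF rows_G_carrier] sd
    by (simp add: dual_code_def span_rows)
  then have "v + w \<in> A \<longleftrightarrow> (\<forall>i<m. (v + w) \<bullet> row G i = 0)"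
    using assms G_carrier by (auto simp: mem_dual_code rows_def)
  also have "\<dots> \<longleftrightarrow> (\<forall>i<m. row G i \<bullet> v = row G i \<bullet> w)"
  proof -
    have "(v + w) \<bullet> row G i = row G i \<bullet> v + row G i \<bullet> w" if "i < m" for i
      using that assms G_carrier
      by (simp add: add_scalar_prod_distrib[of _ "2 * m"] comm_scalar_prod[of "row G i" "2 * m"])
    then show ?thesis by (simp add: bit_add_eq_0_iff)
  qed
  also have "\<dots> \<longleftrightarrow> G *\<^sub>v v = G *\<^sub>v w"
    using G_carrier by (auto simp: vec_eq_iff)
  finally show ?thesis .
qed

text \<open>The generators of the child type code satisfy the membership condition of the extension.
  Conversely, the words of \<open>A\<close> whose lifts lie in the child type code include the span
  of the rows of \<open>G\<close>, and the remaining words of the extension differ from such lifts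
  by \<open>child_word\<close>.\<close>

lemma child_code_eq_extension:
  assumes a: "a \<in> odd_weight_vecs m"
  shows "child_code m G I a = extension (2 * m) A (info_word (2 * m) I a)"
proof -
  let ?n = "2 * m" and ?w = "info_word (2 * m) I a"
  let ?R = "set (rows (extended_generator m G a))"
  let ?E = "extension ?n A ?w" and ?Y = "child_code m G I a"
  have ca: "a \<in> carrier_vec m" using a by (simp add: odd_weight_vecs_def)
  have ww: "?w \<bullet> ?w = 1" using info_word_norm[OF ca] a by simp
  have w0: "?w + ?w = 0\<^sub>v ?n" by (rule bit_vec_add_self) simp
  have E: "linear_code (?n + 2) ?E"
    using dual_code_linear[OF extension_carrier, of ?n A ?w] self_dual_extension[OF sd _ ww] by simp
  have R: "?R = (\<lambda>i. pad ?n (row G i) (a $ i) (a $ i)) ` {..<m}"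
    using row_extended_generator[OF G_carrier]
    by (auto simp: rows_def extended_generator_def lessThan_atLeast0[symmetric] image_iff)
  \<comment> \<open>By this equation the rows of the extended generator matrix are the lifts of the
    rows of \<open>G\<close>.\<close>
  have wrow: "?w \<bullet> row G i = a $ i" if "i < m" for i
  proof -
    have "a $ i = (G *\<^sub>v ?w) $ i" using mult_info_word[OF ca] by simp
    also have "\<dots> = ?w \<bullet> row G i"
      using that G_carrier comm_scalar_prod[of "row G i" "2 * m" ?w] by simp
    finally show ?thesis by simp
  qed
  have RE: "?R \<subseteq> ?E"
    using G_carrier by (auto simp: R mem_extension wrow row_mem)
  have xE: "child_word m I a \<in> ?E"
    unfolding child_word_eq by (subst mem_extension) (simp_all add: ww w0 self_dual_zero[OF sd])
  have "code_span (?n + 2) ?R \<union> {child_word m I a} \<subseteq> ?E"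
    using code_span_minimal[OF E RE] xE by simp
  then have sub: "?Y \<subseteq> ?E"
    unfolding child_code_def by (intro code_span_minimal E)
  have cR: "?R \<subseteq> carrier_vec (?n + 2)" using RE extension_carrier by blast
  have cS: "code_span (?n + 2) ?R \<union> {child_word m I a} \<subseteq> carrier_vec (?n + 2)"
    using linear_code_span[OF cR] by (auto simp: linear_code_iff child_word_eq)
  have Y: "linear_code (?n + 2) ?Y"
    unfolding child_code_def by (intro linear_code_span cS)
  have Y_R: "?R \<subseteq> ?Y" and Y_x: "pad ?n ?w 1 0 \<in> ?Y"
    using code_span_superset[OF cS] code_span_superset[OF cR] unfolding child_code_def child_word_eq by blast+
  have Y_add: "x + y \<in> ?Y" if "x \<in> ?Y" "y \<in> ?Y" for x y
    using Y that by (auto simp: linear_code_iff)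
  have Y_A: "pad ?n u (?w \<bullet> u) (?w \<bullet> u) \<in> ?Y" if "u \<in> A" for u
  proof -
    let ?D = "{u \<in> carrier_vec ?n. pad ?n u (?w \<bullet> u) (?w \<bullet> u) \<in> ?Y}"
    have "linear_code ?n ?D"
      unfolding linear_code_iff
    proof (intro conjI ballI)
      have "pad ?n (0\<^sub>v ?n) 0 0 = 0\<^sub>v (?n + 2)"
        by (intro pad_eqI[symmetric]) auto
      then show "0\<^sub>v ?n \<in> ?D" using Y by (simp add: linear_code_iff)
      fix x y assume xy: "x \<in> ?D" "y \<in> ?D"
      then have "pad ?n x (?w \<bullet> x) (?w \<bullet> x) + pad ?n y (?w \<bullet> y) (?w \<bullet> y) \<in> ?Y"
        using Y_add by simp
      then show "x + y \<in> ?D"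
        using xy by (simp add: pad_add scalar_prod_add_distrib[of _ ?n])
    qed auto
    moreover have "set (rows G) \<subseteq> ?D"
      using Y_R R G_carrier wrow by (auto simp: rows_def)
    ultimately have "code_span (2 * m) (set (rows G)) \<subseteq> ?D"
      by (rule code_span_minimal)
    then have "A \<subseteq> ?D" by (simp only: span_rows)
    then show ?thesis using that by blast
  qed
  have "?E \<subseteq> ?Y"
  proof
    fix v assume v: "v \<in> ?E"
    then obtain b p q where b: "b \<in> carrier_vec ?n" "v = pad ?n b p q"
      unfolding extension_def by blast
    have wb: "?w \<bullet> b = p" and mem: "(if p = q then b else b + ?w) \<in> A"
      using v unfolding b(2) mem_extension[OF b(1)] by simp_all
    show "v \<in> ?Y"
    proof (cases "p = q")
      case True
      then show ?thesis using Y_A[of b] mem wb b by simp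
    next
      case False
      have "?w \<bullet> (b + ?w) = p + 1"
        using b wb ww by (simp add: scalar_prod_add_distrib[of _ ?n])
      then have "pad ?n (b + ?w) (p + 1) (p + 1) \<in> ?Y"
        using Y_A[of "b + ?w"] mem False by simp
      from Y_add[OF this Y_x] have "pad ?n (b + ?w + ?w) (p + 1 + 1) (p + 1) \<in> ?Y"
        using b by (simp add: pad_add)
      moreover have "b + ?w + ?w = b"
        using b by (intro bit_vec_add_cancel) auto
      moreover have "p + 1 + 1 = p" "p + 1 = q" using False by (cases p; cases q; simp)+
      ultimately show ?thesis using b by simp
    qed
  qed
  then show ?thesis using sub by blast
qed

text \<open>The syndrome \<open>G *\<^sub>v w\<close> gives a representative of the coset of
  \<open>w\<close>. Its weight is odd because \<open>w \<bullet> w\<close> is constant on cosets: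
  words of \<open>A\<close> are self-orthogonal and cross terms cancel in pairs.\<close>

lemma info_word_surj:
  assumes w: "w \<in> carrier_vec (2 * m)" "w \<bullet> w = 1"
  obtains a where "a \<in> odd_weight_vecs m" "w + info_word (2 * m) I a \<in> A"
proof -
  let ?n = "2 * m"
  define a where "a = G *\<^sub>v w"
  let ?w = "info_word ?n I a"
  have ca: "a \<in> carrier_vec m" using G_carrier w by (simp add: a_def mult_mat_vec_carrier)
  have mem: "w + ?w \<in> A"
    using mem_code_if_mult_eq[OF w(1), of ?w] mult_info_word[OF ca] by (simp add: a_def)
  have "(w + ?w) \<bullet> (w + ?w) = w \<bullet> w + ?w \<bullet> ?w"
    using w comm_scalar_prod[OF w(1), of ?w]
    by (simp add: scalar_prod_add_distrib[of _ ?n] add_scalar_prod_distrib[of _ ?n] add.assoc)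
  then have "?w \<bullet> ?w = 1"
    using self_dual_orth[OF sd mem mem] w by (simp add: bit_add_eq_0_iff)
  then show ?thesis using that info_word_norm[OF ca] mem by blast
qed

text \<open>The permuted rows of \<open>G\<close> still lie in \<open>A\<close>, so
  \<open>code_expand\<close> gives their coefficients: the matrix consists of the information
  columns of the permuted \<open>G\<close>.\<close>

lemma aut_matrix_exists:
  assumes \<sigma>: "\<sigma> \<in> Aut (2 * m) A"
  obtains M where "M \<in> carrier_mat m m" "G * perm_mat (2 * m) \<sigma> = M * G"
proof
  define P where "P = G * perm_mat (2 * m) \<sigma>"
  define M where "M = mat m m (\<lambda>(i, j). P $$ (i, pick I j))"
  have P: "P \<in> carrier_mat m (2 * m)" using G_carrier by (simp add: P_def)
  show M: "M \<in> carrier_mat m m" by (simp add: M_def)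
  have "P = M * G"
  proof (intro eq_matI)
    fix i k assume "i < dim_row (M * G)" "k < dim_col (M * G)"
    then have ik: "i < m" "k < 2 * m" using M G_carrier by simp_all
    have "row P i \<in> A"
      using \<sigma> row_mem[OF ik(1)] mult_perm_mat_row[OF G_carrier ik(1)]
      by (auto simp: P_def Aut_def perm_code_def simp del: row_mult)
    from code_expand[OF this ik(2)] have "P $$ (i, k) = (\<Sum>j<m. P $$ (i, pick I j) * G $$ (j, k))"
      using ik P pick_info(2) by simp
    also have "\<dots> = (\<Sum>j<m. M $$ (i, j) * G $$ (j, k))"
      using ik by (simp add: M_def)
    also have "\<dots> = (M * G) $$ (i, k)"
      using ik M G_carrier by (simp add: scalar_prod_def atLeast0LessThan)
    finally show "P $$ (i, k) = (M * G) $$ (i, k)" .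
  qed (use P M G_carrier in simp_all)
  then show "G * perm_mat (2 * m) \<sigma> = M * G" by (simp add: P_def)
qed

text \<open>Comparing the information columns, where \<open>G\<close> is the identity, recovers
  \<open>N\<close>. This yields invertibility of the matrices induced by automorphisms.\<close>

lemma mult_G_eq_imp_one:
  assumes N: "N \<in> carrier_mat m m" "N * G = G"
  shows "N = 1\<^sub>m m"
proof (intro eq_matI)
  fix i j assume "i < dim_row (1\<^sub>m m)" "j < dim_col (1\<^sub>m m)"
  then have ij: "i < m" "j < m" by simp_all
  have "G $$ (i, pick I j) = (N * G) $$ (i, pick I j)" by (simp only: N(2))
  also have "\<dots> = (\<Sum>k<m. N $$ (i, k) * G $$ (k, pick I j))"
    using ij N(1) G_carrier pick_info(2)[OF ij(2)] by (simp add: scalar_prod_def atLeast0LessThan)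
  also have "\<dots> = (\<Sum>k<m. if k = j then N $$ (i, k) else 0)"
    using ij by (intro sum.cong) (auto simp: G_pick)
  also have "\<dots> = N $$ (i, j)" using ij by simp
  finally show "N $$ (i, j) = 1\<^sub>m m $$ (i, j)" using ij by (simp add: G_pick)
qed (use N in simp_all)

lemma mult_perm_mat_inverse:
  assumes "\<sigma> permutes {..<2 * m}" "M \<in> carrier_mat m m" "N \<in> carrier_mat m m"
    and "G * perm_mat (2 * m) \<sigma> = M * G"
    and "G * perm_mat (2 * m) (Hilbert_Choice.inv \<sigma>) = N * G"
  shows "M * N = 1\<^sub>m m"
proof (intro mult_G_eq_imp_one)
  let ?P = "perm_mat (2 * m) \<sigma>" and ?Q = "perm_mat (2 * m) (Hilbert_Choice.inv \<sigma>)"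
  have "(M * N) * G = M * (N * G)"
    using assms(2,3) G_carrier by (rule assoc_mult_mat)
  also have "\<dots> = M * (G * ?Q)" using assms(5) by simp
  also have "\<dots> = (M * G) * ?Q"
    using assoc_mult_mat[OF assms(2) G_carrier perm_mat_carrier] by simp
  also have "\<dots> = (G * ?P) * ?Q" using assms(4) by simp
  also have "\<dots> = G * (?P * ?Q)"
    using G_carrier perm_mat_carrier perm_mat_carrier by (rule assoc_mult_mat)
  also have "\<dots> = G"
    using G_carrier by (simp add: perm_mat_inverse[OF assms(1)])
  finally show "(M * N) * G = G" .
qed (use assms in simp)

text \<open>Taking syndromes turns the matrix action on defining vectors into the action of
  automorphisms on cosets of \<open>A\<close>. A matrix for \<open>\<sigma>\<close> acts on cosets
  by the inverse of \<open>\<sigma>\<close>, which is again an automorphism.\<close>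

lemma mem_aut_orbit_iff:
  assumes a: "a \<in> carrier_vec m" and b: "b \<in> carrier_vec m"
  shows "b \<in> aut_orbit m A G a \<longleftrightarrow>
    (\<exists>\<sigma>\<in>Aut (2 * m) A. perm_word (2 * m) \<sigma> (info_word (2 * m) I a) + info_word (2 * m) I b \<in> A)"
proof -
  let ?n = "2 * m" and ?wa = "info_word (2 * m) I a" and ?wb = "info_word (2 * m) I b"
  have act: "M *\<^sub>v a = G *\<^sub>v perm_word ?n (Hilbert_Choice.inv \<sigma>) ?wa"
    if M: "M \<in> carrier_mat m m" "G * perm_mat ?n \<sigma> = M * G" and \<sigma>: "\<sigma> permutes {..<?n}" for M \<sigma>
  proof -
    have "M *\<^sub>v a = M *\<^sub>v (G *\<^sub>v ?wa)" by (simp add: mult_info_word[OF a])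
    also have "\<dots> = (M * G) *\<^sub>v ?wa"
      using assoc_mult_mat_vec[OF M(1) G_carrier, of ?wa] by simp
    also have "\<dots> = G *\<^sub>v (perm_mat ?n \<sigma> *\<^sub>v ?wa)"
      using assoc_mult_mat_vec[OF G_carrier perm_mat_carrier, of ?wa] by (simp flip: M(2))
    finally show ?thesis by (simp add: perm_mat_mult_vec[OF \<sigma>])
  qed
  have orbit_eq: "perm_word ?n \<sigma> ?wa + ?wb \<in> A \<longleftrightarrow> G *\<^sub>v perm_word ?n \<sigma> ?wa = b" for \<sigma>
    using mem_code_if_mult_eq[of "perm_word ?n \<sigma> ?wa" ?wb] mult_info_word[OF b] by simp
  have A: "A \<subseteq> carrier_vec ?n" using dual_code_eq_carrier[OF sd] .
  show ?thesis
  proof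
    assume "b \<in> aut_orbit m A G a"
    then obtain M \<sigma> where M: "b = M *\<^sub>v a" "\<sigma> \<in> Aut ?n A" "M \<in> carrier_mat m m"
      "G * perm_mat ?n \<sigma> = M * G"
      unfolding aut_orbit_def by blast
    then have "\<sigma> permutes {..<?n}" by (simp add: Aut_def)
    then have "perm_word ?n (Hilbert_Choice.inv \<sigma>) ?wa + ?wb \<in> A"
      unfolding orbit_eq using act[OF M(3,4)] M(1) by simp
    then show "\<exists>\<sigma>\<in>Aut ?n A. perm_word ?n \<sigma> ?wa + ?wb \<in> A"
      using Aut_inv[OF M(2) A] by blast
  next
    assume "\<exists>\<sigma>\<in>Aut ?n A. perm_word ?n \<sigma> ?wa + ?wb \<in> A"
    then obtain \<sigma> where \<sigma>: "\<sigma> \<in> Aut ?n A" "G *\<^sub>v perm_word ?n \<sigma> ?wa = b"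
      by (auto simp: orbit_eq)
    let ?\<tau> = "Hilbert_Choice.inv \<sigma>"
    have p: "\<sigma> permutes {..<?n}" using \<sigma> by (simp add: Aut_def)
    have p': "?\<tau> permutes {..<?n}" using p by (rule permutes_inv)
    have ii: "Hilbert_Choice.inv ?\<tau> = \<sigma>" using p by (rule permutes_inv_inv)
    obtain M where M: "M \<in> carrier_mat m m" "G * perm_mat ?n ?\<tau> = M * G"
      using aut_matrix_exists[OF Aut_inv[OF \<sigma>(1) A]] .
    obtain N where N: "N \<in> carrier_mat m m" "G * perm_mat ?n \<sigma> = N * G"
      using aut_matrix_exists[OF \<sigma>(1)] .
    \<comment> \<open>The matrices induced by an automorphism and its inverse are inverse to each
      other, as the orbit definition asks for an invertible matrix.\<close>
    have "M * N = 1\<^sub>m m" "N * M = 1\<^sub>m m"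
      using mult_perm_mat_inverse[OF p' M(1) N(1) M(2)] mult_perm_mat_inverse[OF p N(1) M(1) N(2) M(2)] N(2)
      by (simp_all add: ii)
    then have "invertible_mat M"
      using M(1) N(1) by (auto simp: invertible_mat_def inverts_mat_def)
    moreover have "b = M *\<^sub>v a"
      using act[OF M p'] \<sigma>(2) by (simp add: ii)
    ultimately show "b \<in> aut_orbit m A G a"
      unfolding aut_orbit_def using M Aut_inv[OF \<sigma>(1) A] by blast
  qed
qed

end

section \<open>The algorithm\<close>

text \<open>Composing \<open>\<phi> B\<close> with the inverse of the automorphism from the test
  gives a canonical permutation that preserves the last pair. Conversely, following
  \<open>\<phi> B\<close> by the inverse of such a permutation gives the required
  automorphism.\<close>

lemma parent_test_iff:
  assumes \<phi>: "canonical_perm \<rho> (Suc m) B (\<phi> B)" and B: "B \<subseteq> carrier_vec (2 * m + 2)"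
  shows "parent_test \<phi> (Suc m) B \<longleftrightarrow> pair_equiv (2 * m) B (\<rho> B)"
proof -
  let ?n = "2 * m"
  let ?\<phi> = "\<phi> B" and ?i = "Hilbert_Choice.inv (\<phi> B)"
  have len: "2 * Suc m = ?n + 2" "?n + 2 - 1 = ?n + 1" "?n + 2 - 2 = ?n" by simp_all
  have p: "?\<phi> permutes {..<?n + 2}" and c: "perm_code (?n + 2) ?\<phi> B = \<rho> B"
    using \<phi> unfolding canonical_perm_def len by blast+
  show ?thesis
  proof
    assume "parent_test \<phi> (Suc m) B"
    then obtain c1 c2 \<sigma> where c12: "?\<phi> c1 = ?n + 1" "?\<phi> c2 = ?n"
      and \<sigma>: "\<sigma> \<in> Aut (?n + 2) B" "{\<sigma> c1, \<sigma> c2} = {?n, ?n + 1}"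
      unfolding parent_test_def len by blast
    have \<sigma>p: "\<sigma> permutes {..<?n + 2}" using \<sigma> by (simp add: Aut_def)
    have \<sigma>i: "Hilbert_Choice.inv \<sigma> permutes {..<?n + 2}" using \<sigma>p by (rule permutes_inv)
    have \<sigma>B: "perm_code (?n + 2) (Hilbert_Choice.inv \<sigma>) B = B"
      using Aut_inv[OF \<sigma>(1) B] by (simp add: Aut_def)
    have "perm_code (?n + 2) (?\<phi> \<circ> Hilbert_Choice.inv \<sigma>) B = \<rho> B"
      by (simp only: perm_code_compose[OF p \<sigma>i] \<sigma>B c)
    moreover have "(?\<phi> \<circ> Hilbert_Choice.inv \<sigma>) ` {?n, ?n + 1} = {?n, ?n + 1}"
    proof -
      have "(?\<phi> \<circ> Hilbert_Choice.inv \<sigma>) ` {\<sigma> c1, \<sigma> c2} = {?\<phi> c1, ?\<phi> c2}"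
        by (simp add: permutes_inverses(2)[OF \<sigma>p])
      then show ?thesis unfolding \<sigma>(2) c12 by (simp only: insert_commute)
    qed
    ultimately show "pair_equiv ?n B (\<rho> B)"
      unfolding pair_equiv_def using permutes_compose[OF \<sigma>i p] by blast
  next
    assume "pair_equiv ?n B (\<rho> B)"
    then obtain \<psi> where \<psi>: "\<psi> permutes {..<?n + 2}" "\<psi> ` {?n, ?n + 1} = {?n, ?n + 1}"
      "perm_code (?n + 2) \<psi> B = \<rho> B"
      unfolding pair_equiv_def by blast
    let ?j = "Hilbert_Choice.inv \<psi>"
    have j: "?j permutes {..<?n + 2}" using \<psi>(1) by (rule permutes_inv)
    have "perm_code (?n + 2) (?j \<circ> ?\<phi>) B = B"
      unfolding perm_code_compose[OF j p] c \<psi>(3)[symmetric] by (rule perm_code_inv[OF \<psi>(1) B])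
    then have aut: "?j \<circ> ?\<phi> \<in> Aut (?n + 2) B"
      unfolding Aut_def using permutes_compose[OF p j] by blast
    have "?j ` {?n, ?n + 1} = ?j ` \<psi> ` {?n, ?n + 1}"
      by (simp only: \<psi>(2))
    also have "\<dots> = {?n, ?n + 1}"
      unfolding image_image permutes_inverses(2)[OF \<psi>(1)] by simp
    finally have set: "{?j (?n + 1), ?j ?n} = {?n, ?n + 1}"
      by (simp only: image_insert image_empty insert_commute)
    show "parent_test \<phi> (Suc m) B"
      unfolding parent_test_def len
    proof (intro exI conjI bexI)
      show "?i (?n + 1) < ?n + 2" "?i ?n < ?n + 2"
        using permutes_less[OF permutes_inv[OF p]] by simp_all
      show "?\<phi> (?i (?n + 1)) = ?n + 1" "?\<phi> (?i ?n) = ?n"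
        using permutes_inverses(1)[OF p] by simp_all
      show "{(?j \<circ> ?\<phi>) (?i (?n + 1)), (?j \<circ> ?\<phi>) (?i ?n)} = {?n, ?n + 1}"
        unfolding comp_apply permutes_inverses(1)[OF p] by (rule set)
    qed (rule aut)
  qed
qed

text \<open>The recursion has a single level: codes of dimension \<open>s\<close> are not output but
  augmented, and their children already have the target dimension and are not augmented
  again.\<close>

lemma algorithm_output_step:
  assumes U: "U \<subseteq> self_dual_codes s" and Child: "\<And>A. A \<in> U \<Longrightarrow> Child A \<subseteq> self_dual_codes (s + 1)"
  shows "algorithm_output \<phi> Child s U (s + 1) = {B. \<exists>A\<in>U. B \<in> Child A \<and> parent_test \<phi> (Suc s) B}"
proof -
  have dim: "code_dim (2 * k) C = k" if "C \<in> self_dual_codes k" for k C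
    using that by (simp add: self_dual_codes_def)
  have call: "m = s \<and> B \<in> U \<or> m = Suc s \<and> (\<exists>A\<in>U. B \<in> Child A \<and> parent_test \<phi> (Suc s) B)"
    if "augmentation_call \<phi> Child s U (s + 1) m B" for m B
    using that
  proof induction
    case (recurse m A B)
    then have "m \<noteq> Suc s" using dim[of A "Suc s"] Child by fastforce
    then show ?case using recurse by auto
  qed simp
  show ?thesis
  proof (intro equalityI subsetI)
    fix B assume "B \<in> algorithm_output \<phi> Child s U (s + 1)"
    then obtain m where m: "augmentation_call \<phi> Child s U (s + 1) m B" "code_dim (2 * m) B = s + 1"
      by (auto simp: algorithm_output_def)
    then have "\<not> (m = s \<and> B \<in> U)" using dim[of B s] U by auto
    then show "B \<in> {B. \<exists>A\<in>U. B \<in> Child A \<and> parent_test \<phi> (Suc s) B}"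
      using call[OF m(1)] by blast
  next
    fix B assume "B \<in> {B. \<exists>A\<in>U. B \<in> Child A \<and> parent_test \<phi> (Suc s) B}"
    then obtain A where A: "A \<in> U" "B \<in> Child A" "parent_test \<phi> (Suc s) B" by blast
    have "code_dim (2 * s) A < s + 1" using dim[of A s] A U by auto
    then have "augmentation_call \<phi> Child s U (s + 1) (Suc s) B"
      using A by (intro augmentation_call.recurse[of _ _ _ _ _ s A] augmentation_call.start) auto
    moreover have "code_dim (2 * Suc s) B = s + 1" using dim[of B "s + 1"] A Child by auto
    ultimately show "B \<in> algorithm_output \<phi> Child s U (s + 1)"
      unfolding algorithm_output_def by blast
  qed
qed

section \<open>Correctness of one augmentation step\<close>

theorem theorem9:
  fixes s :: nat
    and \<rho> :: "bcode \<Rightarrow> bcode"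
    and \<phi> :: "bcode \<Rightarrow> nat \<Rightarrow> nat"
    and Child :: "bcode \<Rightarrow> bcode set"
    and U :: "bcode set"
  assumes "s \<ge> 1"
    and "canonical_rep_map \<rho>"
    and "canonical_perm_choice \<rho> \<phi>"
    and "child_map Child"
    and "all_inequivalent s U"
  shows "all_inequivalent (s + 1) (algorithm_output \<phi> Child s U (s + 1))"
proof -
  let ?n = "2 * s"
  have len: "2 * (s + 1) = ?n + 2" "?n + 2 - 2 = ?n" "?n + 2 - 1 = ?n + 1" by simp_all
  have k2: "s + 1 \<ge> 2" using assms(1) by simp
  have sd: "dual_code (?n + 2) B = B" "B \<subseteq> carrier_vec (?n + 2)" if "B \<in> self_dual_codes (s + 1)" for B
  proof -
    show "dual_code (?n + 2) B = B" using that unfolding self_dual_codes_iff len .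
    then show "B \<subseteq> carrier_vec (?n + 2)" by (rule dual_code_eq_carrier)
  qed
  have U: "U \<subseteq> self_dual_codes s" "\<And>X. X \<in> self_dual_codes s \<Longrightarrow> \<exists>!C. C \<in> U \<and> code_equiv ?n X C"
    using assms(5) by (auto simp: all_inequivalent_def)
  have U_sd: "dual_code ?n A = A" "A \<subseteq> carrier_vec ?n" if "A \<in> U" for A
  proof -
    show "dual_code ?n A = A" using that U(1) by (auto simp: self_dual_codes_iff)
    then show "A \<subseteq> carrier_vec ?n" by (rule dual_code_eq_carrier)
  qed
  have \<rho>: "\<rho> X \<in> self_dual_codes (s + 1)" "code_equiv (?n + 2) (\<rho> X) X" "\<not> equal_coords (\<rho> X) ?n (?n + 1)"
    if "X \<in> self_dual_codes (s + 1)" for X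
  proof -
    have "\<rho> X \<in> self_dual_codes (s + 1) \<and> code_equiv (2 * (s + 1)) (\<rho> X) X \<and>
        \<not> equal_coords (\<rho> X) (2 * (s + 1) - 2) (2 * (s + 1) - 1)"
      using assms(2) that k2 unfolding canonical_rep_map_def by blast
    then show "\<rho> X \<in> self_dual_codes (s + 1)" "code_equiv (?n + 2) (\<rho> X) X"
      "\<not> equal_coords (\<rho> X) ?n (?n + 1)"
      unfolding len by blast+
  qed
  have \<rho>_eq: "\<rho> X = \<rho> Y" if "X \<in> self_dual_codes (s + 1)" "Y \<in> self_dual_codes (s + 1)" "code_equiv (?n + 2) X Y" for X Y
    using assms(2) that k2 unfolding canonical_rep_map_def len(1)[symmetric] by blast
  have test: "parent_test \<phi> (Suc s) B \<longleftrightarrow> pair_equiv ?n B (\<rho> B)" if "B \<in> self_dual_codes (s + 1)" for B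
  proof (rule parent_test_iff)
    show "canonical_perm \<rho> (Suc s) B (\<phi> B)"
      using assms(3) that k2 unfolding canonical_perm_choice_def by simp
  qed (use sd that in simp)
  \<comment> \<open>The data behind \<open>Child\<close> are fixed as functions of the parent, so
    that two children of the same parent refer to the same transversal.\<close>
  obtain G I R where gen: "\<And>A. A \<in> U \<Longrightarrow> systematic_generator s A (G A) (I A)"
    and R: "\<And>A. A \<in> U \<Longrightarrow> orbit_transversal s A (G A) (R A)"
    and Child: "\<And>A. A \<in> U \<Longrightarrow> Child A = child_code s (G A) (I A) ` R A"
    using assms(1,4) U(1) unfolding child_map_def by (metis subset_iff)
  define w where "w A a = info_word ?n (I A) a" for A a
  have w_carrier: "w A a \<in> carrier_vec ?n" for A a by (simp add: w_def)
  have R_odd: "R A \<subseteq> odd_weight_vecs s" if "A \<in> U" for A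
    using R[OF that] by (simp add: orbit_transversal_def)
  have odd_carrier: "a \<in> carrier_vec s" if "a \<in> odd_weight_vecs s" for a
    using that by (simp add: odd_weight_vecs_def)
  have w_norm: "w A a \<bullet> w A a = 1" if "A \<in> U" "a \<in> odd_weight_vecs s" for A a
    unfolding w_def
    using info_word_norm[OF gen[OF that(1)] U_sd(1)[OF that(1)] odd_carrier[OF that(2)]] that(2) by simp
  have Child_eq: "Child A = extension ?n A ` w A ` R A" if "A \<in> U" for A
    unfolding Child[OF that] image_image w_def
    using child_code_eq_extension[OF gen[OF that] U_sd(1)[OF that]] R_odd[OF that]
    by (intro image_cong refl) blast
  have orbit: "b \<in> aut_orbit s A (G A) a \<longleftrightarrow> (\<exists>\<sigma>\<in>Aut ?n A. perm_word ?n \<sigma> (w A a) + w A b \<in> A)"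
    if "A \<in> U" "a \<in> odd_weight_vecs s" "b \<in> odd_weight_vecs s" for A a b
    unfolding w_def
    by (intro mem_aut_orbit_iff[OF gen[OF that(1)] U_sd(1)[OF that(1)]] odd_carrier that(2,3))
  have Child_sd: "Child A \<subseteq> self_dual_codes (s + 1)" if AU: "A \<in> U" for A
  proof
    fix B assume "B \<in> Child A"
    then obtain a where a: "a \<in> R A" "B = extension ?n A (w A a)"
      unfolding Child_eq[OF AU] by blast
    then show "B \<in> self_dual_codes (s + 1)"
      unfolding self_dual_codes_iff len a(2)
      using self_dual_extension[OF U_sd(1)[OF AU] w_carrier w_norm[OF AU]] R_odd[OF AU] by blast
  qed
  have out_eq: "algorithm_output \<phi> Child s U (s + 1) = {B. \<exists>A\<in>U. B \<in> Child A \<and> pair_equiv ?n B (\<rho> B)}"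
  proof -
    have "algorithm_output \<phi> Child s U (s + 1) = {B. \<exists>A\<in>U. B \<in> Child A \<and> parent_test \<phi> (Suc s) B}"
      using U(1) Child_sd by (rule algorithm_output_step)
    then show ?thesis using test Child_sd by blast
  qed
  have exists: "\<exists>Y. Y \<in> algorithm_output \<phi> Child s U (s + 1) \<and> code_equiv (?n + 2) X Y"
    if X: "X \<in> self_dual_codes (s + 1)" for X
  proof -
    \<comment> \<open>The construction starts from \<open>\<rho> X\<close> instead of
      \<open>X\<close>, because its last two coordinates are known to be unequal.\<close>
    note Z = \<rho>[OF X]
    obtain A' w' where A': "dual_code ?n A' = A'" and w': "w' \<in> carrier_vec ?n" "w' \<bullet> w' = 1"
      and Z_eq: "\<rho> X = extension ?n A' w'"
      using self_dual_eq_extension[OF sd(1)[OF Z(1)] Z(3)] .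
    obtain A where A: "A \<in> U" "code_equiv ?n A' A"
      using U(2)[of A'] A' by (auto simp: self_dual_codes_iff)
    obtain \<tau> where \<tau>: "\<tau> permutes {..<?n}" "perm_code ?n \<tau> A' = A"
      using A(2) by (auto simp: code_equiv_def)
    let ?v = "perm_word ?n \<tau> w'"
    have v: "?v \<in> carrier_vec ?n" "?v \<bullet> ?v = 1"
      using perm_word_scalar_prod[OF \<tau>(1) w'(1) w'(1)] w'(2) by simp_all
    obtain a where a: "a \<in> odd_weight_vecs s" "?v + w A a \<in> A"
      using info_word_surj[OF gen[OF A(1)] U_sd(1)[OF A(1)] v] unfolding w_def by blast
    obtain b where b: "b \<in> R A" "b \<in> aut_orbit s A (G A) a"
      using R[OF A(1)] a(1) unfolding orbit_transversal_def by blast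
    have b_odd: "b \<in> odd_weight_vecs s" using b R_odd[OF A(1)] by blast
    obtain \<sigma> where \<sigma>: "\<sigma> permutes {..<?n}" "perm_code ?n \<sigma> A = A" "perm_word ?n \<sigma> (w A a) + w A b \<in> A"
      using orbit[OF A(1) a(1) b_odd] b(2) by (auto simp: Aut_def)
    let ?Y = "extension ?n A (w A b)"
    \<comment> \<open>Four moves lead from \<open>\<rho> X\<close> to a child: the parent is carried
      to its representative in \<open>U\<close>, the extra word is replaced by an information word
      in its coset, an automorphism of \<open>A\<close> moves to the orbit representative, and a
      last change within the coset gives \<open>w A b\<close>.\<close>
    have "pair_equiv ?n (\<rho> X) (extension ?n A ?v)"
      using pair_equiv_extension_perm[OF \<tau>(1) dual_code_eq_carrier[OF A'] w'(1)] by (simp only: Z_eq \<tau>(2))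
    moreover have "pair_equiv ?n (extension ?n A ?v) (extension ?n A (w A a))"
      using pair_equiv_extension_translate'[OF U_sd(1)[OF A(1)] v w_carrier a(2)] .
    moreover have "pair_equiv ?n (extension ?n A (w A a)) (extension ?n A (perm_word ?n \<sigma> (w A a)))"
      using pair_equiv_extension_perm[OF \<sigma>(1) U_sd(2)[OF A(1)] w_carrier] by (simp only: \<sigma>(2))
    moreover have "pair_equiv ?n (extension ?n A (perm_word ?n \<sigma> (w A a))) ?Y"
      using pair_equiv_extension_translate'[OF U_sd(1)[OF A(1)] _ _ w_carrier \<sigma>(3)]
        perm_word_scalar_prod[OF \<sigma>(1) w_carrier w_carrier] w_norm[OF A(1) a(1)] by simp
    ultimately have ZY: "pair_equiv ?n (\<rho> X) ?Y"
      using pair_equiv_trans by blast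
    have Y: "?Y \<in> Child A" using b(1) Child_eq[OF A(1)] by blast
    then have Y_sd: "?Y \<in> self_dual_codes (s + 1)" using Child_sd[OF A(1)] by blast
    have XY: "code_equiv (?n + 2) X ?Y"
      using code_equiv_sym[OF sd(2)[OF Z(1)] Z(2)] pair_equiv_imp_code_equiv[OF ZY] code_equiv_trans by blast
    \<comment> \<open>Equivalence of \<open>X\<close> and \<open>?Y\<close> gives
      \<open>\<rho> ?Y = \<rho> X\<close>, so the chain just built is also a certificate that
      \<open>?Y\<close> passes the test.\<close>
    have "pair_equiv ?n ?Y (\<rho> ?Y)"
      using pair_equiv_sym[OF sd(2)[OF Z(1)] ZY] \<rho>_eq[OF X Y_sd XY] by simp
    then show ?thesis using out_eq A(1) Y XY by blast
  qed
  have unique: "Y = Y'"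
    if Y: "Y \<in> algorithm_output \<phi> Child s U (s + 1)" and Y': "Y' \<in> algorithm_output \<phi> Child s U (s + 1)"
      and equiv: "code_equiv (?n + 2) Y Y'" for Y Y'
  proof -
    obtain A b where A: "A \<in> U" "b \<in> R A" "Y = extension ?n A (w A b)" and Y_in: "Y \<in> Child A"
      and Y_test: "pair_equiv ?n Y (\<rho> Y)"
      using Y Child_eq unfolding out_eq by blast
    obtain A' b' where A': "A' \<in> U" "b' \<in> R A'" "Y' = extension ?n A' (w A' b')" and Y'_in: "Y' \<in> Child A'"
      and Y'_test: "pair_equiv ?n Y' (\<rho> Y')"
      using Y' Child_eq unfolding out_eq by blast
    have Y_sd: "Y \<in> self_dual_codes (s + 1)" and Y'_sd: "Y' \<in> self_dual_codes (s + 1)"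
      using Child_sd A(1) A'(1) Y_in Y'_in by blast+
    \<comment> \<open>Both codes are linked to the same representative by permutations that preserve
      the last pair, which upgrades their equivalence to \<open>pair_equiv\<close>.\<close>
    have "\<rho> Y = \<rho> Y'" using \<rho>_eq[OF Y_sd Y'_sd equiv] .
    then have "pair_equiv ?n Y Y'"
      using pair_equiv_trans[OF Y_test] pair_equiv_sym[OF sd(2)[OF Y'_sd] Y'_test] by simp
    then obtain \<sigma> where \<sigma>: "\<sigma> permutes {..<?n}" "perm_code ?n \<sigma> A = A'"
      "perm_word ?n \<sigma> (w A b) + w A' b' \<in> A'"
      using pair_equiv_extension_imp[OF U_sd(1)[OF A(1)] U_sd(1)[OF A'(1)] w_carrier w_carrier]
      unfolding A(3) A'(3) by blast
    have refl: "code_equiv ?n A A"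
      unfolding code_equiv_def using perm_code_id[OF U_sd(2)[OF A(1)]] permutes_id by blast
    have "code_equiv ?n A A'" using \<sigma> by (auto simp: code_equiv_def)
    then have AA': "A' = A"
      using U(2)[of A] refl A(1) A'(1) U(1) by blast
    have odd: "b \<in> odd_weight_vecs s" "b' \<in> odd_weight_vecs s"
      using R_odd A A' by blast+
    have "b' \<in> aut_orbit s A (G A) b"
      using orbit[OF A(1) odd] \<sigma> by (auto simp: AA' Aut_def)
    \<comment> \<open>The identity automorphism puts \<open>b\<close> into its own orbit; as
      \<open>b'\<close> lies there too, the transversal property identifies them.\<close>
    moreover have "b \<in> aut_orbit s A (G A) b"
    proof -
      have "id \<in> Aut ?n A" using perm_code_id[OF U_sd(2)[OF A(1)]] by (simp add: Aut_def permutes_id)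
      moreover have "perm_word ?n id (w A b) + w A b \<in> A"
        using self_dual_zero[OF U_sd(1)[OF A(1)]] bit_vec_add_self[OF w_carrier] perm_word_id[OF w_carrier] by simp
      ultimately show ?thesis using orbit[OF A(1) odd(1) odd(1)] by blast
    qed
    ultimately have "b = b'"
      using R[OF A(1)] odd(1) A(2) A'(2) unfolding orbit_transversal_def AA' by blast
    then show ?thesis using A(3) A'(3) AA' by simp
  qed
  show ?thesis
    unfolding all_inequivalent_def len
  proof (intro conjI ballI)
    show "algorithm_output \<phi> Child s U (s + 1) \<subseteq> self_dual_codes (s + 1)"
      using out_eq Child_sd by blast
    fix X assume X: "X \<in> self_dual_codes (s + 1)"
    show "\<exists>!C. C \<in> algorithm_output \<phi> Child s U (s + 1) \<and> code_equiv (?n + 2) X C"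
      using exists[OF X] unique code_equiv_sym[OF sd(2)[OF X]] code_equiv_trans by blast
  qed
qed

end
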